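(* Let $G$ be a Cohen--Macaulay chordal graph and let $F_1,\ldots,F_m$ be the maximal cliques of $G$ which admit a free vertex. Then $$G=(G-\{w_1,\ldots,w_m\})^{\pi},$$ where each $w_i$ is a free vertex contained in $F_i$ and $\pi=\{F_i\setminus\{w_i\} : 1\le i\le m\}$. That is, $G$ is the clique-whiskered graph of $G-\{w_1,\ldots,w_m\}$ with respect to the clique partition $\pi$, with $w_i$ the whisker vertex attached to the clique $F_i\setminus\{w_i\}$.
   Context: Graphs are finite simple graphs; $\Bbbk$ is a field. The edge ideal $I(G)\subseteq\Bbbk[V(G)]$ is generated by the products $uv$ with $\{u,v\}\in E(G)$; $G$ is Cohen--Macaulay if $\Bbbk[V(G)]/I(G)$ is a Cohen--Macaulay ring. A graph is chordal if every cycle of length at least $4$ has a chord. A clique is a subset $W$ of the vertex set whose induced subgraph is a complete graph; a maximal clique is a clique maximal with respect to inclusion; a free vertex is a vertex belonging to exactly one maximal clique. A clique partition of a graph $H$ is a set $\pi=\{W_1,\ldots,W_r\}$ of cliques $W_i=\{x_{i,1},\ldots,x_{i,|W_i|}\}$ of $H$ whose disjoint union is $V(H)$. The clique-whiskered graph $H^{\pi}$ of $H$ with respect to $\pi$ has vertex set $V(H)\cup\{w_1,\ldots,w_r\}$ (with new vertices $w_i$) and edge set $E(H)\cup\bigcup_{1\le i\le r}\{\{x_{i,j},w_i\} : x_{i,j}\in W_i\}$. $G-A$ denotes the induced subgraph of $G$ on $V(G)\setminus A$. *)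

theory Defs
  imports
    "HOL-Algebra.QuotRing"
    "HOL-Algebra.Ring_Divisibility"
    "HOL-Library.Poly_Mapping"
    "HOL-Library.Extended_Nat"
    "HOL-Library.Disjoint_Sets"
begin

section \<open>Finite simple graphs\<close>

record 'v sgraph =
  verts :: "'v set"
  edges :: "'v set set"

definition simple_graph :: "'v sgraph \<Rightarrow> bool" where
  "simple_graph G \<longleftrightarrow> finite (verts G) \<and> (\<forall>e\<in>edges G. e \<subseteq> verts G \<and> card e = 2)"

definition induced_subgraph :: "'v sgraph \<Rightarrow> 'v set \<Rightarrow> 'v sgraph" where
  "induced_subgraph G W =
     \<lparr>verts = verts G \<inter> W, edges = {e \<in> edges G. e \<subseteq> W}\<rparr>"

definition delete_verts :: "'v sgraph \<Rightarrow> 'v set \<Rightarrow> 'v sgraph" where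
  "delete_verts G A = induced_subgraph G (verts G - A)"

definition complete_graph :: "'v sgraph \<Rightarrow> bool" where
  "complete_graph G \<longleftrightarrow> (\<forall>u\<in>verts G. \<forall>v\<in>verts G. u \<noteq> v \<longrightarrow> {u, v} \<in> edges G)"

text \<open>The empty set is a clique.\<close>

definition clique :: "'v sgraph \<Rightarrow> 'v set \<Rightarrow> bool" where
  "clique G W \<longleftrightarrow> W \<subseteq> verts G \<and> complete_graph (induced_subgraph G W)"

definition maximal_clique :: "'v sgraph \<Rightarrow> 'v set \<Rightarrow> bool" where
  "maximal_clique G W \<longleftrightarrow> clique G W \<and> (\<forall>W'. clique G W' \<and> W \<subseteq> W' \<longrightarrow> W' = W)"

definition free_vertex :: "'v sgraph \<Rightarrow> 'v \<Rightarrow> bool" where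
  "free_vertex G v \<longleftrightarrow> (\<exists>!W. maximal_clique G W \<and> v \<in> W)"

text \<open>A cycle is given by the list of its vertices in cyclic order.\<close>

definition cycle_edges :: "'v list \<Rightarrow> 'v set set" where
  "cycle_edges vs = {{vs ! i, vs ! (Suc i mod length vs)} | i. i < length vs}"

definition graph_cycle :: "'v sgraph \<Rightarrow> 'v list \<Rightarrow> bool" where
  "graph_cycle G vs \<longleftrightarrow>
     length vs \<ge> 3 \<and> distinct vs \<and> set vs \<subseteq> verts G \<and> cycle_edges vs \<subseteq> edges G"

definition chordal :: "'v sgraph \<Rightarrow> bool" where
  "chordal G \<longleftrightarrow>
     (\<forall>vs. graph_cycle G vs \<and> length vs \<ge> 4 \<longrightarrow>
        (\<exists>e\<in>edges G. e \<subseteq> set vs \<and> e \<notin> cycle_edges vs))"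

text \<open>
  Clique partitions are indexed families rather than sets of cliques: the cliques may be empty,
  and several of them may be empty at once (a whisker vertex attached to an empty clique is an
  isolated vertex).
\<close>

definition clique_partition :: "'v sgraph \<Rightarrow> 'i set \<Rightarrow> ('i \<Rightarrow> 'v set) \<Rightarrow> bool" where
  "clique_partition H I W \<longleftrightarrow>
     finite I \<and> (\<forall>i\<in>I. clique H (W i)) \<and> disjoint_family_on W I \<and> (\<Union>i\<in>I. W i) = verts H"

text \<open>
  \<^term>\<open>w i\<close> is the whisker vertex attached to \<^term>\<open>W i\<close>. That the whisker vertices are new
  and pairwise distinct is \<^term>\<open>whisker_vertices H I w\<close>.
\<close>

definition whisker_vertices :: "'v sgraph \<Rightarrow> 'i set \<Rightarrow> ('i \<Rightarrow> 'v) \<Rightarrow> bool" where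
  "whisker_vertices H I w \<longleftrightarrow> inj_on w I \<and> w ` I \<inter> verts H = {}"

definition clique_whiskered ::
  "'v sgraph \<Rightarrow> 'i set \<Rightarrow> ('i \<Rightarrow> 'v set) \<Rightarrow> ('i \<Rightarrow> 'v) \<Rightarrow> 'v sgraph" where
  "clique_whiskered H I W w =
     \<lparr>verts = verts H \<union> w ` I,
      edges = edges H \<union> (\<Union>i\<in>I. {{x, w i} | x. x \<in> W i})\<rparr>"

section \<open>Cohen--Macaulay rings\<close>

text \<open>
  Fractions \<open>r / s\<close> and \<open>r' / s'\<close> are identified if \<open>t (r s' - r' s) = 0\<close> for some \<open>t\<close> in
  the multiplicative set \<open>S\<close>.
\<close>

definition frac_rel :: "('a, 'm) ring_scheme \<Rightarrow> 'a set \<Rightarrow> (('a \<times> 'a) \<times> ('a \<times> 'a)) set" where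
  "frac_rel R S =
     {((r, s), (r', s')) | r s r' s'.
        r \<in> carrier R \<and> s \<in> S \<and> r' \<in> carrier R \<and> s' \<in> S \<and>
        (\<exists>t\<in>S. t \<otimes>\<^bsub>R\<^esub> (r \<otimes>\<^bsub>R\<^esub> s' \<ominus>\<^bsub>R\<^esub> r' \<otimes>\<^bsub>R\<^esub> s) = \<zero>\<^bsub>R\<^esub>)}"

definition localization :: "('a, 'm) ring_scheme \<Rightarrow> 'a set \<Rightarrow> ('a \<times> 'a) set ring" where
  "localization R S =
     \<lparr>carrier = (carrier R \<times> S) // frac_rel R S,
      mult = (\<lambda>X Y. \<Union>(r, s)\<in>X. \<Union>(r', s')\<in>Y.
                frac_rel R S `` {(r \<otimes>\<^bsub>R\<^esub> r', s \<otimes>\<^bsub>R\<^esub> s')}),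
      one = frac_rel R S `` {(\<one>\<^bsub>R\<^esub>, \<one>\<^bsub>R\<^esub>)},
      zero = frac_rel R S `` {(\<zero>\<^bsub>R\<^esub>, \<one>\<^bsub>R\<^esub>)},
      add = (\<lambda>X Y. \<Union>(r, s)\<in>X. \<Union>(r', s')\<in>Y.
                frac_rel R S `` {(r \<otimes>\<^bsub>R\<^esub> s' \<oplus>\<^bsub>R\<^esub> r' \<otimes>\<^bsub>R\<^esub> s, s \<otimes>\<^bsub>R\<^esub> s')})\<rparr>"

definition localization_at :: "('a, 'm) ring_scheme \<Rightarrow> 'a set \<Rightarrow> ('a \<times> 'a) set ring" where
  "localization_at R P = localization R (carrier R - P)"

definition krull_dim :: "('a, 'm) ring_scheme \<Rightarrow> enat" where
  "krull_dim R =
     Sup {enat n | n. \<exists>P. (\<forall>i\<le>n. primeideal (P i) R) \<and> (\<forall>i<n. P i \<subset> P (Suc i))}"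

text \<open>
  The second conjunct says that multiplication by \<open>xs ! i\<close> is injective on the quotient of \<open>R\<close>
  by the ideal generated by the preceding elements.
\<close>

definition regular_sequence :: "('a, 'm) ring_scheme \<Rightarrow> 'a list \<Rightarrow> bool" where
  "regular_sequence R xs \<longleftrightarrow>
     set xs \<subseteq> carrier R \<and>
     (\<forall>i<length xs. \<forall>a\<in>carrier R.
        xs ! i \<otimes>\<^bsub>R\<^esub> a \<in> genideal R (set (take i xs)) \<longrightarrow> a \<in> genideal R (set (take i xs))) \<and>
     genideal R (set xs) \<noteq> carrier R"

definition depth :: "('a, 'm) ring_scheme \<Rightarrow> 'a set \<Rightarrow> enat" where
  "depth R M = Sup {enat (length xs) | xs. set xs \<subseteq> M \<and> regular_sequence R xs}"

definition noetherian_local_ring :: "('a, 'm) ring_scheme \<Rightarrow> bool" where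
  "noetherian_local_ring R \<longleftrightarrow> cring R \<and> noetherian_ring R \<and> (\<exists>!M. maximalideal M R)"

definition cohen_macaulay_local_ring :: "('a, 'm) ring_scheme \<Rightarrow> bool" where
  "cohen_macaulay_local_ring R \<longleftrightarrow>
     noetherian_local_ring R \<and> (\<forall>M. maximalideal M R \<longrightarrow> depth R M = krull_dim R)"

definition cohen_macaulay_ring :: "('a, 'm) ring_scheme \<Rightarrow> bool" where
  "cohen_macaulay_ring R \<longleftrightarrow>
     cring R \<and> noetherian_ring R \<and>
     (\<forall>M. maximalideal M R \<longrightarrow> cohen_macaulay_local_ring (localization_at R M))"

section \<open>Edge ideals\<close>

text \<open>
  A polynomial is a finitely supported map from monomials to coefficients, and a monomial a
  finitely supported map from variables to exponents. The polynomial ring over the variable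
  set \<open>V\<close> consists of the polynomials all of whose monomials involve only variables from \<open>V\<close>.
\<close>

type_synonym ('v, 'k) mpoly = "('v \<Rightarrow>\<^sub>0 nat) \<Rightarrow>\<^sub>0 'k"

definition mpoly_ring :: "'v set \<Rightarrow> ('v, 'k::field) mpoly ring" where
  "mpoly_ring V =
     \<lparr>carrier = {p. \<forall>m\<in>Poly_Mapping.keys p. Poly_Mapping.keys m \<subseteq> V},
      mult = (*), one = 1, zero = 0, add = (+)\<rparr>"

definition mpoly_var :: "'v \<Rightarrow> ('v, 'k::field) mpoly" where
  "mpoly_var v = Poly_Mapping.single (Poly_Mapping.single v 1) 1"

definition edge_ideal :: "'v sgraph \<Rightarrow> ('v, 'k::field) mpoly set" where
  "edge_ideal G =
     genideal (mpoly_ring (verts G)) {mpoly_var u * mpoly_var v | u v. {u, v} \<in> edges G}"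

definition cohen_macaulay_graph :: "'k::field itself \<Rightarrow> 'v sgraph \<Rightarrow> bool" where
  "cohen_macaulay_graph _ G \<longleftrightarrow>
     cohen_macaulay_ring
       ((mpoly_ring (verts G) :: ('v, 'k) mpoly ring) Quot edge_ideal G)"

end

theory Submission
  imports Defs "HOL-Computational_Algebra.Polynomial"
begin

text \<open>
  Call a graph well-covered if all its maximal independent sets have the same size. The proof shows
  that a Cohen--Macaulay graph is well-covered, and that in a well-covered chordal graph the maximal
  cliques with a free vertex partition the vertex set. The conclusion then is a matter of unfolding
  definitions: all neighbours of a free vertex \<open>w\<^sub>i\<close> lie in \<open>F\<^sub>i\<close>, so \<open>w\<^sub>i\<close> is a whisker on
  \<open>F\<^sub>i - {w\<^sub>i}\<close>.

  Algebra (\<open>cohen_macaulay_well_covered\<close>). Localize the quotient by the edge ideal at the ideal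
  generated by the variables. Each independent set \<open>S\<close> yields a chain of primes of length \<open>card S\<close>.
  Conversely, the depth is at most \<open>card T\<close> for each maximal independent set \<open>T\<close>
  (\<open>depth_le_maximal_independent\<close>): the product of the variables in \<open>T\<close> generates an ideal of the
  quotient that is, as a module, the polynomial ring in the variables \<open>T\<close>, on which any \<open>card T + 1\<close> elements satisfy a nontrivial
  polynomial relation with constant coefficients, by counting monomials. A regular sequence admits no
  such relation on a nonzero element (\<open>regular_chain_independent\<close>), by Krull's intersection theorem and
  induction. As depth and dimension agree, \<open>card S \<le> card T\<close>.

  Graphs (\<open>well_covered_clique_whiskered\<close>). Two different maximal cliques with free vertices \<open>u\<close> and
  \<open>v\<close> are disjoint, since a common vertex could be exchanged for \<open>u\<close> and \<open>v\<close> in a maximal independent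
  set. To see that they cover all vertices, cover the chordal graph by at most as many cliques as some
  independent set has vertices (\<open>clique_cover\<close>). If the graph is well-covered, each of these cliques meets
  every maximal independent set. In a chordal graph a clique without a vertex whose neighbours all lie
  in the clique is dominated by an independent set outside it (\<open>independent_dominating_clique\<close>), and a
  maximal independent set extending this one misses the clique. So each clique of the cover is
  a maximal clique with a free vertex.
\<close>

section \<open>Independent sets and cliques in chordal graphs\<close>

locale finite_graph =
  fixes G :: "'v sgraph"
  assumes simple: "simple_graph G"
begin

abbreviation adj :: "'v \<Rightarrow> 'v \<Rightarrow> bool" where
  "adj u v \<equiv> {u, v} \<in> edges G"

lemma finite_verts: "finite (verts G)"
  using simple by (simp add: simple_graph_def)

lemma adj_sym: "adj u v \<longleftrightarrow> adj v u"
  by (simp add: insert_commute)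

lemma adj_irrefl: "\<not> adj u u"
  using simple by (fastforce simp: simple_graph_def)

lemma adj_verts: "adj u v \<Longrightarrow> u \<in> verts G \<and> v \<in> verts G"
  using simple by (fastforce simp: simple_graph_def)

lemma edge_cases:
  assumes "e \<in> edges G"
  obtains u v where "e = {u, v}" "u \<noteq> v"
  using assms simple by (auto simp: simple_graph_def card_2_iff)

lemma clique_iff:
  "clique G W \<longleftrightarrow> W \<subseteq> verts G \<and> (\<forall>u\<in>W. \<forall>v\<in>W. u \<noteq> v \<longrightarrow> adj u v)"
  by (auto simp: clique_def complete_graph_def induced_subgraph_def)

definition independent :: "'v set \<Rightarrow> bool" where
  "independent S \<longleftrightarrow> S \<subseteq> verts G \<and> (\<forall>u\<in>S. \<forall>v\<in>S. \<not> adj u v)"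

text \<open>
  Maximal independent sets are encoded as independent sets that dominate all remaining vertices.
\<close>
definition maximal_independent :: "'v set \<Rightarrow> bool" where
  "maximal_independent T \<longleftrightarrow> independent T \<and> (\<forall>v\<in>verts G - T. \<exists>t\<in>T. adj v t)"

lemma independent_finite: "independent S \<Longrightarrow> finite S"
  using finite_verts finite_subset by (auto simp: independent_def)

lemma independent_insert:
  assumes "independent S" "x \<in> verts G" "\<And>s. s \<in> S \<Longrightarrow> \<not> adj x s"
  shows "independent (insert x S)"
  using assms adj_sym adj_irrefl by (auto simp: independent_def)

lemma independent_extend:
  assumes "independent S"
  obtains T where "S \<subseteq> T" "maximal_independent T"
proof -
  have "\<exists>T. S \<subseteq> T \<and> maximal_independent T"
    using assms
  proof (induction "card (verts G - S)" arbitrary: S rule: less_induct)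
    case less
    show ?case
    proof (cases "maximal_independent S")
      case False
      then obtain v where v: "v \<in> verts G - S" "\<forall>s\<in>S. \<not> adj v s"
        using less.prems by (auto simp: maximal_independent_def)
      have "verts G - insert v S \<subset> verts G - S"
        using v by auto
      then have "card (verts G - insert v S) < card (verts G - S)"
        using finite_verts by (simp add: psubset_card_mono)
      moreover have "independent (insert v S)"
        using independent_insert less.prems v by auto
      ultimately show ?thesis
        using less.hyps by blast
    qed auto
  qed
  then show ?thesis using that by blast
qed

lemma clique_Int_independent:
  assumes "clique G Q" "independent T"
  shows "card (Q \<inter> T) \<le> 1"
proof -
  have "finite (Q \<inter> T)"
    using assms independent_finite by auto
  then show ?thesis
    using assms unfolding One_nat_def card_le_Suc0_iff_eq[OF \<open>finite (Q \<inter> T)\<close>]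
    by (meson IntD1 IntD2 clique_iff independent_def)
qed

end

locale chordal_graph = finite_graph G for G :: "'v sgraph" +
  assumes chordal: "chordal G"
begin

lemma cycle_has_chord:
  assumes "4 \<le> length vs" "distinct vs" "set vs \<subseteq> verts G"
    and steps: "\<And>i. Suc i < length vs \<Longrightarrow> adj (vs ! i) (vs ! Suc i)"
    and closing: "adj (vs ! (length vs - 1)) (vs ! 0)"
  obtains i j where "i < j" "j < length vs" "adj (vs ! i) (vs ! j)" "j \<noteq> Suc i"
    "\<not> (i = 0 \<and> j = length vs - 1)"
proof -
  have mod_Suc_eq: "Suc i mod length vs = (if Suc i < length vs then Suc i else 0)"
    if "i < length vs" for i
    using that by (metis Suc_lessI mod_less mod_self)
  have ce: "{vs ! i, vs ! (Suc i mod length vs)} \<in> edges G" if "i < length vs" for i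
  proof (cases "Suc i < length vs")
    case True
    then show ?thesis using steps by simp
  next
    case False
    then have "i = length vs - 1" using that by simp
    then show ?thesis using closing mod_Suc_eq[OF that] False by simp
  qed
  have "cycle_edges vs \<subseteq> edges G"
    unfolding cycle_edges_def using ce by blast
  then have "graph_cycle G vs"
    using assms by (simp add: graph_cycle_def)
  then obtain e where e: "e \<in> edges G" "e \<subseteq> set vs" "e \<notin> cycle_edges vs"
    using chordal assms(1) unfolding chordal_def by blast
  obtain u v where uv: "e = {u, v}" "u \<noteq> v"
    using e(1) edge_cases by blast
  then obtain a b where ab: "a < length vs" "b < length vs" "vs ! a = u" "vs ! b = v"
    using e(2) by (metis in_set_conv_nth insert_subset)
  define i j where "i = min a b" and "j = max a b"
  have "a \<noteq> b" using ab uv by auto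
  then have ij: "i < j" "j < length vs" "e = {vs ! i, vs ! j}"
    using ab uv unfolding i_def j_def by (auto simp: min_def max_def)
  have n1: "j \<noteq> Suc i"
  proof
    assume "j = Suc i"
    then have "e = {vs ! i, vs ! (Suc i mod length vs)}" using ij by simp
    then have "e \<in> cycle_edges vs" using ij unfolding cycle_edges_def by auto
    then show False using e(3) by simp
  qed
  have n2: "\<not> (i = 0 \<and> j = length vs - 1)"
  proof
    assume "i = 0 \<and> j = length vs - 1"
    then have "e = {vs ! j, vs ! (Suc j mod length vs)}" using ij mod_Suc_eq[of j]
      by (auto simp: insert_commute)
    then have "e \<in> cycle_edges vs" using ij(2) unfolding cycle_edges_def by blast
    then show False using e(3) by simp
  qed
  show ?thesis
    using that ij n1 n2 e(1) by blast
qed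

text \<open>
  The one place where chordality enters. A walk outside a clique \<open>Q\<close> starts at a vertex adjacent
  to all of \<open>K \<subseteq> Q\<close> and ends at a neighbour of \<open>q \<in> Q\<close>; then some vertex of the walk is adjacent to
  all of \<open>K \<union> {q}\<close>. After shortening, the walk is an induced path and only its end is adjacent to
  \<open>q\<close>. If some \<open>k \<in> K\<close> were not adjacent to the end, then the part of the path after the last
  neighbour of \<open>k\<close>, closed up by \<open>q\<close> and \<open>k\<close>, would be a chordless cycle of length at least four.
\<close>
lemma walk_merge:
  assumes Q: "clique G Q"
    and p: "p \<noteq> []" "set p \<subseteq> verts G - Q" "successively adj p"
    and K: "K \<subseteq> Q" "\<And>k. k \<in> K \<Longrightarrow> adj k (hd p)"
    and q: "q \<in> Q" "adj q (last p)"
  shows "\<exists>z\<in>set p. \<forall>k\<in>insert q K. adj k z"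
  using p K(2) q(2)
proof (induction "length p" arbitrary: p rule: less_induct)
  case (less p)
  note prems = less.prems
  let ?n = "length p"
  have nth_step: "adj (p ! i) (p ! Suc i)" if "Suc i < ?n" for i
    using prems(3) that by (simp add: successively_conv_nth)
  consider (repeat) "\<not> distinct p"
    | (short) i j where "Suc i < j" "j < ?n" "adj (p ! i) (p ! j)" "distinct p"
    | (early) i where "Suc i < ?n" "adj q (p ! i)"
    | (induced) "distinct p" "\<And>i j. Suc i < j \<Longrightarrow> j < ?n \<Longrightarrow> \<not> adj (p ! i) (p ! j)"
        "\<And>i. Suc i < ?n \<Longrightarrow> \<not> adj q (p ! i)"
    by blast
  then show ?case
  proof cases
    case repeat
    then obtain xs ys zs y where dec: "p = xs @ [y] @ ys @ [y] @ zs"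
      using not_distinct_decomp by blast
    let ?p = "xs @ [y] @ zs"
    have "\<exists>z\<in>set ?p. \<forall>k\<in>insert q K. adj k z"
    proof (rule less.hyps)
      show "length ?p < length p" "?p \<noteq> []" "set ?p \<subseteq> verts G - Q"
        using dec prems(2) by auto
      show "successively adj ?p"
        using prems(3) unfolding dec by (auto simp: successively_append_iff successively_Cons)
      show "adj k (hd ?p)" if "k \<in> K" for k
        using prems(4)[OF that] unfolding dec by (cases xs) auto
      show "adj q (last ?p)"
        using prems(5) unfolding dec by (cases zs) auto
    qed
    then show ?thesis using dec by auto
  next
    case short
    define xs zs where "xs = take (Suc i) p" and "zs = drop j p"
    have ne: "xs \<noteq> []" "zs \<noteq> []" using short prems(1) by (auto simp: xs_def zs_def)
    have sub: "set (xs @ zs) \<subseteq> set p"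
      using set_take_subset set_drop_subset by (fastforce simp: xs_def zs_def)
    have "\<exists>z\<in>set (xs @ zs). \<forall>k\<in>insert q K. adj k z"
    proof (rule less.hyps)
      show "length (xs @ zs) < length p" "xs @ zs \<noteq> []"
        using short ne by (auto simp: xs_def zs_def)
      show "set (xs @ zs) \<subseteq> verts G - Q"
        using sub prems(2) by auto
      have "last xs = p ! i" "hd zs = p ! j"
        using short by (auto simp: xs_def zs_def take_Suc_conv_app_nth hd_drop_conv_nth)
      moreover have "successively adj xs" "successively adj zs"
        unfolding xs_def zs_def using prems(3) by (auto simp: successively_conv_nth)
      ultimately show "successively adj (xs @ zs)"
        using short by (simp add: successively_append_iff)
      have "hd (xs @ zs) = hd p" "last (xs @ zs) = last p"
        using ne short by (auto simp: xs_def zs_def hd_append)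
      then show "adj k (hd (xs @ zs))" if "k \<in> K" for k
        using prems(4)[OF that] by simp
      show "adj q (last (xs @ zs))"
        using \<open>last (xs @ zs) = last p\<close> prems(5) by simp
    qed
    then show ?thesis using sub by blast
  next
    case early
    let ?p = "take (Suc i) p"
    have "\<exists>z\<in>set ?p. \<forall>k\<in>insert q K. adj k z"
    proof (rule less.hyps)
      show "length ?p < length p" "?p \<noteq> []" using early prems(1) by auto
      show "set ?p \<subseteq> verts G - Q" using prems(2) set_take_subset by fastforce
      show "successively adj ?p" using prems(3) by (auto simp: successively_conv_nth)
      show "adj k (hd ?p)" if "k \<in> K" for k using prems(4)[OF that] by simp
      show "adj q (last ?p)" using early by (simp add: take_Suc_conv_app_nth)
    qed
    then show ?thesis using set_take_subset by fastforce
  next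
    case induced
    have last_eq: "last p = p ! (?n - 1)" using prems(1) by (simp add: last_conv_nth)
    have "adj k (last p)" if k: "k \<in> K" for k
    proof (rule ccontr)
      assume nk: "\<not> adj k (last p)"
      then have kq: "k \<noteq> q" using prems(5) by auto
      \<comment> \<open>the last vertex of the path that is adjacent to \<open>k\<close>\<close>
      define I where "I = {i. i < ?n \<and> adj k (p ! i)}"
      have "finite I" "0 \<in> I"
        using prems(1) prems(4)[OF k] by (auto simp: I_def hd_conv_nth)
      define i where "i = Max I"
      have "i \<in> I" unfolding i_def using \<open>finite I\<close> \<open>0 \<in> I\<close> Max_in by blast
      have imax: "\<And>j. j \<in> I \<Longrightarrow> j \<le> i" unfolding i_def using \<open>finite I\<close> by simp
      have i: "i < ?n" "adj k (p ! i)" using \<open>i \<in> I\<close> by (auto simp: I_def)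
      have "i \<noteq> ?n - 1" using i nk last_eq by auto
      then have i2: "Suc i < ?n" using i by simp
      define vs where "vs = k # drop i p @ [q]"
      let ?m = "?n - i"
      have len: "length vs = ?m + 2" by (simp add: vs_def)
      have v0: "vs ! 0 = k" by (simp add: vs_def)
      have vm: "vs ! Suc t = p ! (i + t)" if "t < ?m" for t
        using that i by (simp add: vs_def nth_append)
      have vl: "vs ! Suc ?m = q" using i by (simp add: vs_def nth_append)
      have kQ: "k \<in> Q" using k K(1) by auto
      have QV: "Q \<subseteq> verts G" using Q by (simp add: clique_iff)
      have "distinct vs"
        unfolding vs_def using induced(1) kQ q(1) kq prems(2) set_drop_subset[of i p] by auto
      moreover have "set vs \<subseteq> verts G"
        unfolding vs_def using kQ q(1) QV prems(2) set_drop_subset[of i p] by auto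
      moreover have "adj (vs ! j) (vs ! Suc j)" if "Suc j < length vs" for j
      proof (cases j)
        case 0
        then show ?thesis using v0 vm[of 0] i by simp
      next
        case (Suc t)
        show ?thesis
        proof (cases "Suc t < ?m")
          case True
          then show ?thesis using Suc vm[of t] vm[of "Suc t"] nth_step[of "i + t"] by simp
        next
          case False
          then have "t = ?m - 1" "t < ?m" using that Suc len i2 by auto
          then have "vs ! Suc t = last p" using vm[of t] last_eq i2 by simp
          moreover have "vs ! Suc (Suc t) = q" using vl \<open>t = ?m - 1\<close> i2 by (simp add: Suc_diff_Suc)
          ultimately show ?thesis using Suc prems(5) adj_sym by simp
        qed
      qed
      moreover have "adj (vs ! (length vs - 1)) (vs ! 0)"
        using vl v0 len Q kQ q(1) kq by (auto simp: clique_iff)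
      moreover have "4 \<le> length vs" using len i2 by simp
      ultimately obtain a b where ab: "a < b" "b < length vs" "adj (vs ! a) (vs ! b)" "b \<noteq> Suc a"
          "\<not> (a = 0 \<and> b = length vs - 1)"
        using cycle_has_chord by blast
      obtain b' where b': "b = Suc b'" using ab(1) by (cases b) auto
      show False
      proof (cases a)
        case 0
        then have "b' < ?m" "0 < b'" using ab len b' by auto
        then have "adj k (p ! (i + b'))" using ab(3) 0 b' v0 vm by simp
        then have "i + b' \<in> I" using \<open>b' < ?m\<close> by (simp add: I_def)
        then show False using imax[of "i + b'"] \<open>0 < b'\<close> by simp
      next
        case (Suc a')
        then have a': "a' < ?m" using ab len b' by auto
        show False
        proof (cases "b' < ?m")
          case True
          then have "adj (p ! (i + a')) (p ! (i + b'))" using ab(3) vm a' Suc b' by simp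
          then show False using induced(2)[of "i + a'" "i + b'"] True ab(1,4) Suc b' by simp
        next
          case False
          then have b'': "b' = ?m" using ab(2) len b' by simp
          then have "adj (p ! (i + a')) q" using ab(3) vm vl a' Suc b' by simp
          moreover have "Suc (i + a') < ?n" using ab(4) Suc b' b'' a' by simp
          ultimately show False using induced(3) adj_sym by blast
        qed
      qed
    qed
    then show ?thesis using prems(1,5) last_in_set by blast
  qed
qed

text \<open>
  The connected component of \<open>x\<close> in the subgraph induced on \<open>X\<close>. For \<open>x \<notin> X\<close> it is \<open>{x}\<close>.
\<close>
definition component :: "'v set \<Rightarrow> 'v \<Rightarrow> 'v set" where
  "component X x = {y. (\<lambda>u v. u \<in> X \<and> v \<in> X \<and> adj u v)\<^sup>*\<^sup>* x y}"

lemma component_self: "x \<in> component X x"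
  by (simp add: component_def)

lemma component_step:
  assumes "y \<in> component X x" "y \<in> X" "z \<in> X" "adj y z"
  shows "z \<in> component X x"
  using assms unfolding component_def by (auto intro: rtranclp.rtrancl_into_rtrancl)

lemma component_subset: "x \<in> X \<Longrightarrow> component X x \<subseteq> X"
  unfolding component_def by (auto elim: rtranclp.cases)

lemma component_eq:
  assumes "y \<in> component X x"
  shows "component X y = component X x"
proof -
  let ?R = "\<lambda>u v. u \<in> X \<and> v \<in> X \<and> adj u v"
  have "symp ?R" using adj_sym by (auto simp: symp_def)
  then have "symp ?R\<^sup>*\<^sup>*" by (rule symp_rtranclp)
  moreover have xy: "?R\<^sup>*\<^sup>* x y" using assms by (simp add: component_def)
  ultimately have "?R\<^sup>*\<^sup>* y x" by (meson sympD)
  then show ?thesis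
    using xy unfolding component_def by (auto intro: rtranclp_trans)
qed

lemma component_walk:
  assumes "y \<in> component X x"
  shows "\<exists>p. p \<noteq> [] \<and> set p \<subseteq> component X x \<and> successively adj p \<and> hd p = x \<and> last p = y"
proof -
  have "(\<lambda>u v. u \<in> X \<and> v \<in> X \<and> adj u v)\<^sup>*\<^sup>* x y"
    using assms by (simp add: component_def)
  then show ?thesis
  proof (induction rule: rtranclp_induct)
    case base
    show ?case using component_self by (intro exI[of _ "[x]"]) simp
  next
    case (step y z)
    then obtain p where p: "p \<noteq> []" "set p \<subseteq> component X x" "successively adj p" "hd p = x" "last p = y"
      by blast
    have "z \<in> component X x"
      using step p component_step last_in_set by blast
    then show ?case
      using p step by (intro exI[of _ "p @ [z]"]) (simp add: successively_append_iff)
  qed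
qed

text \<open>
  Every component \<open>D\<close> of the complement of a clique \<open>Q\<close> contains a single vertex that is adjacent
  to all vertices of \<open>Q\<close> having a neighbour in \<open>D\<close>: take a vertex of \<open>D\<close> with the largest number of
  neighbours in \<open>Q\<close> and apply \<open>walk_merge\<close>. Here \<open>X\<close> is any set of vertices outside \<open>Q\<close>.
\<close>
lemma component_dominator:
  assumes Q: "clique G Q" and X: "X \<subseteq> verts G - Q" and x: "x \<in> X"
  obtains c where "c \<in> component X x" "\<And>y q. y \<in> component X x \<Longrightarrow> q \<in> Q \<Longrightarrow> adj q y \<Longrightarrow> adj q c"
proof -
  define C where "C = component X x"
  define K where "K y = {q \<in> Q. adj q y}" for y
  have finQ: "finite Q" using Q finite_verts finite_subset by (auto simp: clique_iff)
  have CX: "C \<subseteq> X" using component_subset x by (simp add: C_def)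
  have "finite C" using CX X finite_verts by (meson Diff_subset finite_subset)
  moreover have "C \<noteq> {}" using component_self by (auto simp: C_def)
  ultimately have "Max ((\<lambda>y. card (K y)) ` C) \<in> (\<lambda>y. card (K y)) ` C" by simp
  then obtain c where c: "c \<in> C" "Max ((\<lambda>y. card (K y)) ` C) = card (K c)" by blast
  then have max: "card (K y) \<le> card (K c)" if "y \<in> C" for y
    using that \<open>finite C\<close> by (metis Max_ge finite_imageI imageI)
  have "adj q c" if y: "y \<in> C" and q: "q \<in> Q" "adj q y" for y q
  proof -
    have "y \<in> component X c"
      using y c(1) component_eq by (simp add: C_def)
    then obtain p where p: "p \<noteq> []" "set p \<subseteq> component X c" "successively adj p" "hd p = c" "last p = y"
      using component_walk by blast
    have "component X c = C" using c(1) component_eq by (simp add: C_def)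
    then have pC: "set p \<subseteq> C" using p by simp
    have "\<exists>z\<in>set p. \<forall>k\<in>insert q (K c). adj k z"
      by (rule walk_merge[OF Q]) (use p q pC CX X in \<open>auto simp: K_def\<close>)
    then obtain z where z: "z \<in> C" "\<And>k. k \<in> insert q (K c) \<Longrightarrow> adj k z"
      using pC by blast
    have "insert q (K c) \<subseteq> K z" using z q(1) by (auto simp: K_def)
    moreover have "finite (K z)" using finQ by (simp add: K_def)
    ultimately have "card (insert q (K c)) \<le> card (K c)"
      using max[OF z(1)] by (meson card_mono le_trans)
    moreover have "finite (K c)" using finQ by (simp add: K_def)
    ultimately have "q \<in> K c" by (metis card_insert_disjoint not_less_eq_eq order_refl)
    then show ?thesis by (simp add: K_def)
  qed
  then show ?thesis using that c(1) by (auto simp: C_def)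
qed

text \<open>
  Dirac's theorem in a form suited to induction: an induced subgraph on \<open>W\<close> that is larger than the
  clique \<open>Q\<close> has a simplicial vertex outside \<open>Q\<close>. Let \<open>c\<close> be the vertex that \<open>component_dominator\<close>
  gives in a component \<open>C\<close> of \<open>W - Q\<close>, and \<open>K\<close> the set of its neighbours in \<open>Q\<close>. If \<open>C = {c}\<close>, then
  \<open>c\<close> is simplicial. Otherwise the induction hypothesis applies to \<open>K \<union> C\<close> and the clique \<open>K \<union> {c}\<close>.
\<close>
lemma simplicial_outside_clique:
  assumes "W \<subseteq> verts G" "clique G Q" "Q \<subset> W"
  shows "\<exists>s\<in>W - Q. clique G (insert s {u \<in> W. adj s u})"
  using assms
proof (induction "card (W - Q)" arbitrary: W Q rule: less_induct)
  case less
  note prems = less.prems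
  obtain x where x: "x \<in> W - Q" using prems by blast
  define C where "C = component (W - Q) x"
  obtain c where c: "c \<in> C" "\<And>y q. y \<in> C \<Longrightarrow> q \<in> Q \<Longrightarrow> adj q y \<Longrightarrow> adj q c"
    using component_dominator[OF prems(2), of "W - Q" x] prems(1) x C_def by blast
  have CW: "C \<subseteq> W - Q" using component_subset[OF x] by (simp add: C_def)
  define K where "K = {q \<in> Q. adj q c}"
  have nbr: "u \<in> K \<union> C" if "y \<in> C" "u \<in> W" "adj y u" for y u
  proof (cases "u \<in> Q")
    case True
    then show ?thesis using c(2)[OF that(1) True] that adj_sym by (auto simp: K_def)
  next
    case False
    then show ?thesis using component_step[of y "W - Q" x u] that CW by (auto simp: C_def)
  qed
  have Qc: "clique G (insert c K)"
    using prems(1,2) c(1) CW adj_sym by (auto simp: clique_iff K_def)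
  show ?case
  proof (cases "C = {c}")
    case True
    have "insert c {u \<in> W. adj c u} \<subseteq> insert c K"
      using nbr[OF c(1)] True by blast
    then have "clique G (insert c {u \<in> W. adj c u})"
      using Qc by (meson clique_iff subset_iff)
    then show ?thesis using c(1) CW by blast
  next
    case False
    let ?W = "K \<union> C"
    have KQ: "K \<subseteq> Q" by (auto simp: K_def)
    have WQ: "?W - insert c K = C - {c}" using KQ CW by blast
    have "finite (W - Q)" using finite_verts prems(1) finite_subset by blast
    moreover have "C - {c} \<subset> W - Q" using CW c(1) by blast
    ultimately have "card (?W - insert c K) < card (W - Q)"
      unfolding WQ by (rule psubset_card_mono)
    moreover have "?W \<subseteq> verts G" using KQ CW prems by blast
    moreover have "insert c K \<subset> ?W" using False c(1) WQ by blast
    ultimately obtain s where s: "s \<in> C - {c}" "clique G (insert s {u \<in> ?W. adj s u})"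
      using less.hyps[of ?W "insert c K"] Qc WQ by metis
    have "{u \<in> W. adj s u} \<subseteq> {u \<in> ?W. adj s u}"
      using nbr s(1) by blast
    then have "clique G (insert s {u \<in> W. adj s u})"
      using s(2) unfolding clique_iff by blast
    then show ?thesis using s(1) CW by blast
  qed
qed

text \<open>
  Peeling off closed neighbourhoods of simplicial vertices covers \<open>W\<close> by at most as many cliques as
  there are vertices in some independent set.
\<close>
lemma clique_cover:
  assumes "W \<subseteq> verts G"
  shows "\<exists>S \<Q>. independent S \<and> S \<subseteq> W \<and> finite \<Q> \<and> (\<forall>Q\<in>\<Q>. clique G Q) \<and> \<Union>\<Q> = W \<and> card \<Q> \<le> card S"
  using assms
proof (induction "card W" arbitrary: W rule: less_induct)
  case less
  show ?case
  proof (cases "W = {}")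
    case True
    then show ?thesis by (intro exI[of _ "{}"]) (simp add: independent_def)
  next
    case False
    have "clique G {}" by (simp add: clique_iff)
    then obtain s where s: "s \<in> W" "clique G (insert s {u \<in> W. adj s u})"
      using simplicial_outside_clique[of W "{}"] less.prems False by auto
    let ?N = "insert s {u \<in> W. adj s u}"
    have finW: "finite W" using less.prems finite_verts finite_subset by blast
    have less': "card (W - ?N) < card W" "W - ?N \<subseteq> verts G"
      using finW s(1) less.prems by (auto intro!: psubset_card_mono)
    obtain S \<Q> where IH: "independent S" "S \<subseteq> W - ?N" "finite \<Q>" "\<forall>Q\<in>\<Q>. clique G Q"
        "\<Union>\<Q> = W - ?N" "card \<Q> \<le> card S"
      using less.hyps[OF less'] by (elim exE conjE) (rule that)
    have "independent (insert s S)"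
      using IH(1,2) s(1) less.prems by (intro independent_insert) auto
    moreover have "card (insert ?N \<Q>) \<le> card (insert s S)"
    proof -
      have "card (insert ?N \<Q>) \<le> Suc (card \<Q>)" by (rule card_insert_le_m1) (use IH(3) in auto)
      moreover have "card (insert s S) = Suc (card S)"
        using IH(2) independent_finite[OF IH(1)] by (subst card_insert_disjoint) auto
      ultimately show ?thesis using IH(6) by simp
    qed
    moreover have "\<Union>(insert ?N \<Q>) = W" using IH(5) s(1) by auto
    ultimately show ?thesis
      using IH s less.prems by (intro exI[of _ "insert s S"] exI[of _ "insert ?N \<Q>"]) auto
  qed
qed

text \<open>
  If every vertex of the clique \<open>Q\<close> has a neighbour outside \<open>Q\<close>, some independent set disjoint from
  \<open>Q\<close> dominates \<open>Q\<close>: choose one dominating vertex in each component of the complement of \<open>Q\<close>.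
\<close>
lemma independent_dominating_clique:
  assumes Q: "clique G Q" and out: "\<And>q. q \<in> Q \<Longrightarrow> \<exists>x\<in>verts G - Q. adj q x"
  shows "\<exists>D. independent D \<and> D \<inter> Q = {} \<and> (\<forall>q\<in>Q. \<exists>d\<in>D. adj q d)"
proof -
  let ?X = "verts G - Q"
  have "\<exists>c. \<forall>x\<in>?X. c (component ?X x) \<in> component ?X x \<and>
      (\<forall>y\<in>component ?X x. \<forall>q\<in>Q. adj q y \<longrightarrow> adj q (c (component ?X x)))"
  proof -
    have "\<forall>C\<in>component ?X ` ?X. \<exists>c. c \<in> C \<and> (\<forall>y\<in>C. \<forall>q\<in>Q. adj q y \<longrightarrow> adj q c)"
    proof
      fix C assume "C \<in> component ?X ` ?X"
      then obtain x where x: "x \<in> ?X" "C = component ?X x" by blast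
      show "\<exists>c. c \<in> C \<and> (\<forall>y\<in>C. \<forall>q\<in>Q. adj q y \<longrightarrow> adj q c)"
        unfolding x(2) by (rule component_dominator[OF Q order_refl x(1)]) blast
    qed
    then obtain c where "\<forall>C\<in>component ?X ` ?X. c C \<in> C \<and> (\<forall>y\<in>C. \<forall>q\<in>Q. adj q y \<longrightarrow> adj q (c C))"
      by (rule bchoice[THEN exE])
    then show ?thesis by (intro exI[of _ c]) simp
  qed
  then obtain c where c: "\<And>x. x \<in> ?X \<Longrightarrow> c (component ?X x) \<in> component ?X x"
    and dom: "\<And>x y q. x \<in> ?X \<Longrightarrow> y \<in> component ?X x \<Longrightarrow> q \<in> Q \<Longrightarrow> adj q y \<Longrightarrow> adj q (c (component ?X x))"
    by blast
  define D where "D = (\<lambda>x. c (component ?X x)) ` ?X"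
  have DX: "D \<subseteq> ?X" using c component_subset[of _ ?X] unfolding D_def by blast
  moreover have "\<not> adj u v" if uvD: "u \<in> D" "v \<in> D" for u v
  proof
    assume uv: "adj u v"
    obtain x y where x: "x \<in> ?X" "u = c (component ?X x)" and y: "y \<in> ?X" "v = c (component ?X y)"
      using uvD unfolding D_def by blast
    have "v \<in> component ?X x"
      using component_step[of u ?X x v] c[OF x(1)] x uv uvD DX by blast
    moreover have "v \<in> component ?X y" using c[OF y(1)] y by simp
    ultimately have "component ?X x = component ?X y" using component_eq by metis
    then show False using x y uv adj_irrefl by simp
  qed
  ultimately have "independent D" by (auto simp: independent_def)
  moreover have "\<exists>d\<in>D. adj q d" if "q \<in> Q" for q
    using out[OF that] dom that component_self unfolding D_def by blast
  ultimately show ?thesis using DX by blast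
qed

text \<open>
  In a well-covered chordal graph every maximal independent set meets every clique of the cover
  given by \<open>clique_cover\<close>. By \<open>independent_dominating_clique\<close>, each clique of the cover then
  contains a vertex all of whose neighbours lie in that clique.
\<close>
lemma well_covered_simplicial_cover:
  assumes wc: "\<And>S T. independent S \<Longrightarrow> maximal_independent T \<Longrightarrow> card S \<le> card T"
    and v: "v \<in> verts G"
  shows "\<exists>Q s. clique G Q \<and> v \<in> Q \<and> s \<in> Q \<and> (\<forall>x. adj s x \<longrightarrow> x \<in> Q)"
proof -
  obtain S \<Q> where S: "independent S" "finite \<Q>" "\<forall>Q\<in>\<Q>. clique G Q" "\<Union>\<Q> = verts G" "card \<Q> \<le> card S"
    using clique_cover[of "verts G"] by blast
  obtain Q where Q: "Q \<in> \<Q>" "v \<in> Q" using S(4) v by blast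
  have "\<exists>s\<in>Q. \<forall>x. adj s x \<longrightarrow> x \<in> Q"
  proof (rule ccontr)
    assume "\<not> ?thesis"
    then have "\<exists>x\<in>verts G - Q. adj q x" if "q \<in> Q" for q
      using that adj_verts by blast
    then obtain D where D: "independent D" "D \<inter> Q = {}" "\<forall>q\<in>Q. \<exists>d\<in>D. adj q d"
      using independent_dominating_clique S(3) Q(1) by blast
    obtain T where T: "D \<subseteq> T" "maximal_independent T"
      using independent_extend[OF D(1)] by blast
    have iT: "independent T" using T(2) by (simp add: maximal_independent_def)
    have "Q \<inter> T = {}"
      using D(3) T(1) iT unfolding independent_def by blast
    moreover have "T \<subseteq> \<Union>\<Q>" using iT S(4) by (simp add: independent_def)
    ultimately have "T = (\<Union>Q'\<in>\<Q> - {Q}. Q' \<inter> T)" by blast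
    then have "card T \<le> (\<Sum>Q'\<in>\<Q> - {Q}. card (Q' \<inter> T))"
      using card_UN_le[of "\<Q> - {Q}" "\<lambda>Q'. Q' \<inter> T"] S(2) by simp
    also have "\<dots> \<le> (\<Sum>Q'\<in>\<Q> - {Q}. 1)"
      using clique_Int_independent S(3) iT by (intro sum_mono) auto
    also have "\<dots> < card \<Q>"
      using card_Diff1_less[OF S(2) Q(1)] by simp
    also have "\<dots> \<le> card T"
      using S(5) wc[OF S(1) T(2)] by simp
    finally show False by simp
  qed
  then show ?thesis using Q S(3) by blast
qed

end

context finite_graph
begin

lemma clique_extend:
  assumes "clique G W"
  obtains M where "W \<subseteq> M" "maximal_clique G M"
proof -
  have "finite {C. clique G C}"
    using finite_verts by (rule_tac finite_subset[of _ "Pow (verts G)"]) (auto simp: clique_iff)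
  then obtain M where "M \<in> {C. clique G C}" "W \<subseteq> M" "\<forall>C\<in>{C. clique G C}. M \<subseteq> C \<longrightarrow> C = M"
    using assms finite_has_maximal2[of "{C. clique G C}" W] by auto
  then show ?thesis using that by (auto simp: maximal_clique_def)
qed

lemma free_vertex_nbr:
  assumes "maximal_clique G M" "u \<in> M" "free_vertex G u" "adj u x"
  shows "x \<in> M"
proof -
  have "clique G {u, x}" using assms(4) adj_verts adj_sym by (auto simp: clique_iff)
  then obtain M' where "{u, x} \<subseteq> M'" "maximal_clique G M'" using clique_extend by blast
  then show ?thesis using assms(1-3) unfolding free_vertex_def by blast
qed

lemma simplicial_free:
  assumes "clique G Q" "s \<in> Q" "\<And>x. adj s x \<Longrightarrow> x \<in> Q"
  shows "maximal_clique G Q" "free_vertex G s"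
proof -
  have sub: "C \<subseteq> Q" if "clique G C" "s \<in> C" for C
    using that assms(2,3) by (metis clique_iff subsetI)
  then show mc: "maximal_clique G Q"
    using assms(1,2) unfolding maximal_clique_def by blast
  show "free_vertex G s"
    unfolding free_vertex_def
  proof (rule ex1I[of _ Q])
    show "maximal_clique G Q \<and> s \<in> Q" using mc assms(2) by simp
    show "C = Q" if "maximal_clique G C \<and> s \<in> C" for C
      using that sub assms(1) unfolding maximal_clique_def by blast
  qed
qed

text \<open>
  If \<open>x\<close> lay in two different maximal cliques with free vertices \<open>u\<close> and \<open>v\<close>, then replacing \<open>x\<close> by \<open>u\<close> and \<open>v\<close> in a
  maximal independent set containing \<open>x\<close> would give a larger independent set.
\<close>
lemma well_covered_simplices_disjoint:
  assumes wc: "\<And>S T. independent S \<Longrightarrow> maximal_independent T \<Longrightarrow> card S \<le> card T"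
    and M: "maximal_clique G M" "u \<in> M" "free_vertex G u"
    and N: "maximal_clique G N" "v \<in> N" "free_vertex G v"
    and "M \<noteq> N"
  shows "M \<inter> N = {}"
proof (rule ccontr)
  assume "M \<inter> N \<noteq> {}"
  then obtain x where x: "x \<in> M" "x \<in> N" by blast
  have cl: "clique G M" "clique G N" using M N by (auto simp: maximal_clique_def)
  have xV: "x \<in> verts G" and V: "u \<in> verts G" "v \<in> verts G"
    using cl x M(2) N(2) by (auto simp: clique_iff)
  have unN: "u \<notin> N" and vnM: "v \<notin> M"
    using M N \<open>M \<noteq> N\<close> unfolding free_vertex_def by blast+
  then have nuv: "\<not> adj u v" "u \<noteq> v" using free_vertex_nbr[OF M] M by auto
  have "independent {x}" using xV adj_irrefl by (auto simp: independent_def)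
  then obtain T where T: "{x} \<subseteq> T" "maximal_independent T"
    using independent_extend by blast
  then have iT: "independent T" by (simp add: maximal_independent_def)
  have only: "t = x" if "t \<in> T" "t \<in> M \<or> t \<in> N" for t
    using that x cl iT T(1) unfolding clique_iff independent_def by blast
  have uv: "u \<notin> T" "v \<notin> T" using only M(2) N(2) x unN vnM by auto
  have iT': "independent (T - {x})" using iT by (auto simp: independent_def)
  have "independent (insert v (T - {x}))"
    using iT' V(2) free_vertex_nbr[OF N] only by (intro independent_insert) auto
  then have "independent (insert u (insert v (T - {x})))"
    by (rule independent_insert) (use V(1) free_vertex_nbr[OF M] only nuv in auto)
  then have "card (insert u (insert v (T - {x}))) \<le> card T"
    using wc T(2) by blast
  moreover have "card (insert u (insert v (T - {x}))) = card T + 1"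
  proof -
    have "card T = Suc (card (T - {x}))"
      using card.remove[OF independent_finite[OF iT], of x] T(1) by simp
    then show ?thesis using independent_finite[OF iT] uv nuv(2) by simp
  qed
  ultimately show False by simp
qed

end

context chordal_graph
begin

lemma well_covered_clique_whiskered:
  fixes F :: "nat \<Rightarrow> 'v set" and w :: "nat \<Rightarrow> 'v" and m :: nat
  assumes wc: "\<And>S T. independent S \<Longrightarrow> maximal_independent T \<Longrightarrow> card S \<le> card T"
    and F: "bij_betw F {1..m} {C. maximal_clique G C \<and> (\<exists>v\<in>C. free_vertex G v)}"
    and w: "\<forall>i\<in>{1..m}. w i \<in> F i \<and> free_vertex G (w i)"
  shows "clique_partition (delete_verts G (w ` {1..m})) {1..m} (\<lambda>i. F i - {w i}) \<and>
         whisker_vertices (delete_verts G (w ` {1..m})) {1..m} w \<and>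
         G = clique_whiskered (delete_verts G (w ` {1..m})) {1..m} (\<lambda>i. F i - {w i}) w"
proof -
  let ?I = "{1..m}" and ?H = "delete_verts G (w ` {1..m})"
  have mc: "maximal_clique G (F i)" if "i \<in> ?I" for i
    using F that by (auto simp: bij_betw_def)
  then have cl: "clique G (F i)" if "i \<in> ?I" for i
    using that by (simp add: maximal_clique_def)
  have disj: "F i \<inter> F j = {}" if "i \<in> ?I" "j \<in> ?I" "i \<noteq> j" for i j
  proof (rule well_covered_simplices_disjoint[OF wc])
    show "F i \<noteq> F j" using F that by (meson bij_betw_def inj_onD)
  qed (use that mc w in auto)
  have cover: "\<exists>i\<in>?I. v \<in> F i" if "v \<in> verts G" for v
  proof -
    obtain Q s where "clique G Q" "v \<in> Q" "s \<in> Q" "\<forall>x. adj s x \<longrightarrow> x \<in> Q"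
      using well_covered_simplicial_cover[OF wc \<open>v \<in> verts G\<close>] by blast
    then have "Q \<in> F ` ?I" "v \<in> Q"
      using simplicial_free[of Q s] F unfolding bij_betw_def by auto
    then show ?thesis by blast
  qed
  have wF: "w i \<in> F i" if "i \<in> ?I" for i using w that by simp
  have FV: "F i \<subseteq> verts G" if "i \<in> ?I" for i using cl that by (simp add: clique_iff)
  have wV: "w ` ?I \<subseteq> verts G" using wF FV by blast
  have whisker: "F i \<inter> w ` ?I = {w i}" if "i \<in> ?I" for i
    using wF disj that by blast
  have vH: "verts ?H = verts G - w ` ?I"
    by (auto simp: delete_verts_def induced_subgraph_def)
  have eH: "edges ?H = {e \<in> edges G. e \<subseteq> verts G - w ` ?I}"
    by (simp add: delete_verts_def induced_subgraph_def)
  have sub: "F i - {w i} \<subseteq> verts G - w ` ?I" if "i \<in> ?I" for i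
    using whisker[OF that] FV[OF that] by blast
  have "clique ?H (F i - {w i})" if "i \<in> ?I" for i
  proof -
    have "{u, v} \<in> edges ?H" if "u \<in> F i - {w i}" "v \<in> F i - {w i}" "u \<noteq> v" for u v
      using that cl[OF \<open>i \<in> ?I\<close>] sub[OF \<open>i \<in> ?I\<close>] unfolding eH clique_iff by blast
    then show ?thesis
      using sub[OF that] unfolding clique_def complete_graph_def induced_subgraph_def vH
      by auto
  qed
  moreover have "disjoint_family_on (\<lambda>i. F i - {w i}) ?I"
    using disj unfolding disjoint_family_on_def by blast
  moreover have "(\<Union>i\<in>?I. F i - {w i}) = verts ?H"
    unfolding vH
  proof (intro equalityI UN_least subsetI)
    fix v assume v: "v \<in> verts G - w ` ?I"
    then obtain i where "i \<in> ?I" "v \<in> F i" using cover by blast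
    then show "v \<in> (\<Union>i\<in>?I. F i - {w i})" using v by blast
  qed (use sub in blast)
  ultimately have "clique_partition ?H ?I (\<lambda>i. F i - {w i})"
    by (simp add: clique_partition_def)
  moreover have "whisker_vertices ?H ?I w"
  proof -
    have "inj_on w ?I"
    proof (rule inj_onI, rule ccontr)
      fix i j assume ij: "i \<in> ?I" "j \<in> ?I" "w i = w j" "i \<noteq> j"
      then have "w i \<in> F i \<inter> F j" using wF[OF ij(1)] wF[OF ij(2)] by simp
      then show False using disj[OF ij(1,2,4)] by simp
    qed
    then show ?thesis unfolding whisker_vertices_def vH by blast
  qed
  moreover have "edges G = edges ?H \<union> (\<Union>i\<in>?I. {{x, w i} | x. x \<in> F i - {w i}})"
  proof (intro equalityI subsetI)
    fix e assume e: "e \<in> edges G"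
    show "e \<in> edges ?H \<union> (\<Union>i\<in>?I. {{x, w i} | x. x \<in> F i - {w i}})"
    proof (cases "e \<inter> w ` ?I = {}")
      case True
      moreover have "e \<subseteq> verts G" using e simple by (simp add: simple_graph_def)
      ultimately show ?thesis using e unfolding eH by blast
    next
      case False
      then obtain i where i: "i \<in> ?I" "w i \<in> e" by blast
      obtain a b where "e = {a, b}" "a \<noteq> b" using edge_cases[OF e] .
      then obtain x where x: "e = {x, w i}" "x \<noteq> w i"
        using i(2) by (cases "w i = a") auto
      then have "x \<in> F i"
        using free_vertex_nbr[OF mc[OF i(1)] wF[OF i(1)], of x] w i(1) e
        by (simp add: insert_commute)
      then show ?thesis using x i(1) by blast
    qed
  next
    fix e assume "e \<in> edges ?H \<union> (\<Union>i\<in>?I. {{x, w i} | x. x \<in> F i - {w i}})"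
    then consider "e \<in> edges ?H" | i x where "i \<in> ?I" "x \<in> F i - {w i}" "e = {x, w i}"
      by blast
    then show "e \<in> edges G"
    proof cases
      case 1
      then show ?thesis unfolding eH by blast
    next
      case 2
      then show ?thesis using cl[OF 2(1)] wF[OF 2(1)] by (simp add: clique_iff)
    qed
  qed
  moreover have "verts G = verts ?H \<union> w ` ?I"
    using vH wV by blast
  ultimately show ?thesis
    by (intro conjI sgraph.equality) (simp_all only: clique_whiskered_def sgraph.simps, simp)
qed

end

section \<open>Regular sequences and algebraic independence\<close>

text \<open>
  More vectors than coordinates are linearly dependent; proved by Gaussian elimination.
\<close>
lemma linear_dependence:
  fixes v :: "'a \<Rightarrow> 'e \<Rightarrow> 'k::field"
  assumes "finite E" "finite L" "card E < card L"
  shows "\<exists>c. (\<exists>a\<in>L. c a \<noteq> 0) \<and> (\<forall>e\<in>E. (\<Sum>a\<in>L. c a * v a e) = 0)"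
  using assms
proof (induction E arbitrary: L v rule: finite_induct)
  case empty
  then have "L \<noteq> {}" by auto
  then show ?case by (intro exI[of _ "\<lambda>_. 1"]) auto
next
  case (insert e0 E)
  show ?case
  proof (cases "\<forall>a\<in>L. v a e0 = 0")
    case True
    have "card E < card L" using insert.prems insert.hyps by simp
    then obtain c where "\<exists>a\<in>L. c a \<noteq> 0" "\<forall>e\<in>E. (\<Sum>a\<in>L. c a * v a e) = 0"
      using insert.IH[OF insert.prems(1)] by blast
    then show ?thesis using True by (intro exI[of _ c]) simp
  next
    case False
    then obtain a0 where a0: "a0 \<in> L" "v a0 e0 \<noteq> 0" by blast
    let ?L = "L - {a0}"
    have "card E < card ?L"
      using insert.prems insert.hyps a0(1) by simp
    then obtain c where c: "\<exists>a\<in>?L. c a \<noteq> 0"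
      "\<forall>e\<in>E. (\<Sum>a\<in>?L. c a * (v a e - v a e0 / v a0 e0 * v a0 e)) = 0"
      using insert.IH[of ?L "\<lambda>a e. v a e - v a e0 / v a0 e0 * v a0 e"] insert.prems(1) by blast
    define b where "b = c(a0 := - (\<Sum>a\<in>?L. c a * v a e0 / v a0 e0))"
    have sum_b: "(\<Sum>a\<in>L. b a * v a e) = (\<Sum>a\<in>?L. c a * (v a e - v a e0 / v a0 e0 * v a0 e))" for e
    proof -
      have "(\<Sum>a\<in>L. b a * v a e) = b a0 * v a0 e + (\<Sum>a\<in>?L. b a * v a e)"
        using a0(1) insert.prems(1) by (simp add: sum.remove)
      also have "(\<Sum>a\<in>?L. b a * v a e) = (\<Sum>a\<in>?L. c a * v a e)"
        by (intro sum.cong) (auto simp: b_def)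
      also have "b a0 * v a0 e = - (\<Sum>a\<in>?L. c a * (v a e0 / v a0 e0 * v a0 e))"
        by (simp add: b_def sum_distrib_right mult.assoc)
      finally show ?thesis by (simp add: right_diff_distrib sum_subtractf)
    qed
    have "\<exists>a\<in>L. b a \<noteq> 0" using c(1) by (auto simp: b_def)
    moreover have "(\<Sum>a\<in>L. b a * v a e) = 0" if "e \<in> insert e0 E" for e
      unfolding sum_b using that c(2) a0(2) by auto
    ultimately show ?thesis by blast
  qed
qed

text \<open>
  The polynomial ring over a given set of variables is a subring, given as a set, of the type of all
  polynomials. Subrings and their ideals are therefore handled as sets inside a commutative ring.
\<close>
definition subring_set :: "'r::comm_ring_1 set \<Rightarrow> bool" where
  "subring_set C \<longleftrightarrow> 1 \<in> C \<and> (\<forall>a\<in>C. \<forall>b\<in>C. a + b \<in> C \<and> a - b \<in> C \<and> a * b \<in> C)"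

text \<open>
  \<open>J\<close> is an ideal of the subring \<open>C\<close>. Negatives are multiples by \<open>- 1 \<in> C\<close>.
\<close>
definition ideal_of :: "'r::comm_ring_1 set \<Rightarrow> 'r set \<Rightarrow> bool" where
  "ideal_of C J \<longleftrightarrow> J \<subseteq> C \<and> 0 \<in> J \<and> (\<forall>a\<in>J. \<forall>b\<in>J. a + b \<in> J) \<and> (\<forall>c\<in>C. \<forall>a\<in>J. c * a \<in> J)"

lemma subring_setD:
  assumes "subring_set C"
  shows "1 \<in> C" "0 \<in> C" "a \<in> C \<Longrightarrow> b \<in> C \<Longrightarrow> a + b \<in> C" "a \<in> C \<Longrightarrow> b \<in> C \<Longrightarrow> a - b \<in> C"
    "a \<in> C \<Longrightarrow> b \<in> C \<Longrightarrow> a * b \<in> C" "a \<in> C \<Longrightarrow> - a \<in> C" "a \<in> C \<Longrightarrow> a ^ n \<in> C"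
proof -
  have one: "1 \<in> C"
    and ops: "\<And>a b. a \<in> C \<Longrightarrow> b \<in> C \<Longrightarrow> a + b \<in> C \<and> a - b \<in> C \<and> a * b \<in> C"
    using assms by (auto simp: subring_set_def)
  have zero: "0 \<in> C" using ops[OF one one] by simp
  show "1 \<in> C" "0 \<in> C" by (fact one zero)+
  show "a \<in> C \<Longrightarrow> b \<in> C \<Longrightarrow> a + b \<in> C" "a \<in> C \<Longrightarrow> b \<in> C \<Longrightarrow> a - b \<in> C"
    "a \<in> C \<Longrightarrow> b \<in> C \<Longrightarrow> a * b \<in> C"
    using ops by auto
  show "a \<in> C \<Longrightarrow> - a \<in> C" using ops[OF zero, of a] by simp
  show "a \<in> C \<Longrightarrow> a ^ n \<in> C"
    using ops one by (induction n) auto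
qed

lemma subring_set_sum:
  assumes "subring_set C" "\<And>x. x \<in> X \<Longrightarrow> g x \<in> C"
  shows "sum g X \<in> C"
  using assms(2)
proof (induction X rule: infinite_finite_induct)
  case (insert x F)
  then show ?case using subring_setD(3)[OF assms(1)] by simp
qed (simp_all add: subring_setD(2)[OF assms(1)])

lemma ideal_ofD:
  assumes "subring_set C" "ideal_of C J"
  shows "J \<subseteq> C" "0 \<in> J" "a \<in> J \<Longrightarrow> b \<in> J \<Longrightarrow> a + b \<in> J" "c \<in> C \<Longrightarrow> a \<in> J \<Longrightarrow> c * a \<in> J"
    "c \<in> C \<Longrightarrow> a \<in> J \<Longrightarrow> a * c \<in> J" "a \<in> J \<Longrightarrow> b \<in> J \<Longrightarrow> a - b \<in> J"
proof -
  have add: "\<And>a b. a \<in> J \<Longrightarrow> b \<in> J \<Longrightarrow> a + b \<in> J"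
    and mult: "\<And>c a. c \<in> C \<Longrightarrow> a \<in> J \<Longrightarrow> c * a \<in> J"
    using assms(2) by (auto simp: ideal_of_def)
  show "J \<subseteq> C" "0 \<in> J" using assms(2) by (auto simp: ideal_of_def)
  show "a \<in> J \<Longrightarrow> b \<in> J \<Longrightarrow> a + b \<in> J" by (fact add)
  show "c \<in> C \<Longrightarrow> a \<in> J \<Longrightarrow> c * a \<in> J" by (fact mult)
  show "c \<in> C \<Longrightarrow> a \<in> J \<Longrightarrow> a * c \<in> J"
    using mult[of c a] by (simp add: mult.commute)
  have "- 1 \<in> C" using subring_setD(1,6)[OF assms(1)] by blast
  then show "a \<in> J \<Longrightarrow> b \<in> J \<Longrightarrow> a - b \<in> J"
    using add[of a "- 1 * b"] mult[of "- 1" b] by simp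
qed

text \<open>
  The monomial with exponents \<open>as\<close> in the ring elements \<open>fs\<close>; surplus entries of the longer list are
  ignored.
\<close>
fun mpow :: "'r::comm_ring_1 list \<Rightarrow> nat list \<Rightarrow> 'r" where
  "mpow (f # fs) (a # as) = f ^ a * mpow fs as"
| "mpow _ _ = 1"

text \<open>
  The exponent vectors of length \<open>d\<close> with all entries below \<open>N\<close>.
\<close>
definition exps :: "nat \<Rightarrow> nat \<Rightarrow> nat list set" where
  "exps d N = {as. set as \<subseteq> {..<N} \<and> length as = d}"

lemma finite_exps: "finite (exps d N)"
  by (simp add: exps_def finite_lists_length_eq)

lemma card_exps: "card (exps d N) = N ^ d"
  by (simp add: exps_def card_lists_length_eq)

lemma sum_exps_Suc: "(\<Sum>as\<in>exps (Suc d) N. g as) = (\<Sum>a<N. \<Sum>as\<in>exps d N. g (a # as))"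
proof -
  let ?c = "\<lambda>(a, as). a # as"
  have img: "exps (Suc d) N = ?c ` ({..<N} \<times> exps d N)"
    by (force simp: exps_def length_Suc_conv image_iff)
  have inj: "inj_on ?c ({..<N} \<times> exps d N)"
    by (auto simp: inj_on_def)
  have "(\<Sum>as\<in>exps (Suc d) N. g as) = (\<Sum>x\<in>{..<N} \<times> exps d N. g (?c x))"
    unfolding img by (rule sum.reindex[OF inj, unfolded o_def])
  also have "\<dots> = (\<Sum>a<N. \<Sum>as\<in>exps d N. g (a # as))"
    by (subst sum.cartesian_product) (simp add: case_prod_beta')
  finally show ?thesis .
qed

lemma mpow_closed: "subring_set C \<Longrightarrow> set fs \<subseteq> C \<Longrightarrow> mpow fs as \<in> C"
  by (induction fs as rule: mpow.induct) (auto simp: subring_setD)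

text \<open>
  The properties that a regular sequence \<open>fs\<close> in a Noetherian local ring retains when it is pulled back
  to a ring \<open>C\<close> mapping to the local ring: \<open>J i\<close> is the preimage of the ideal generated by the first
  \<open>i\<close> elements. The last condition is the trace of Krull's intersection theorem: an element \<open>y\<close>
  outside \<open>J i\<close> is, up to a factor \<open>u\<close>, congruent modulo \<open>J i\<close> to a power of the next element times
  some \<open>z\<close> that survives modulo \<open>J (Suc i)\<close>.
\<close>
definition regular_chain :: "'r::comm_ring_1 set \<Rightarrow> (nat \<Rightarrow> 'r set) \<Rightarrow> 'r list \<Rightarrow> bool" where
  "regular_chain C J fs \<longleftrightarrow> set fs \<subseteq> C \<and> (\<forall>i\<le>length fs. ideal_of C (J i)) \<and>
     (\<forall>i<length fs. J i \<subseteq> J (Suc i) \<and> fs ! i \<in> J (Suc i) \<and>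
        (\<forall>g\<in>C. fs ! i * g \<in> J i \<longrightarrow> g \<in> J i) \<and>
        (\<forall>y\<in>C - J i. \<exists>u\<in>C. \<exists>z\<in>C - J (Suc i). \<exists>r. u * y - (fs ! i) ^ r * z \<in> J i))"

lemma regular_chain_tail:
  assumes "regular_chain C J (f # fs)"
  shows "regular_chain C (\<lambda>i. J (Suc i)) fs"
  unfolding regular_chain_def
proof (intro conjI allI impI)
  show "set fs \<subseteq> C" using assms by (simp add: regular_chain_def)
  show "ideal_of C (J (Suc i))" if "i \<le> length fs" for i
    using assms that by (simp add: regular_chain_def)
  fix i assume "i < length fs"
  then have "Suc i < length (f # fs)" by simp
  then show "J (Suc i) \<subseteq> J (Suc (Suc i))" "fs ! i \<in> J (Suc (Suc i))"
    "\<forall>g\<in>C. fs ! i * g \<in> J (Suc i) \<longrightarrow> g \<in> J (Suc i)"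
    "\<forall>y\<in>C - J (Suc i). \<exists>u\<in>C. \<exists>z\<in>C - J (Suc (Suc i)). \<exists>r. u * y - (fs ! i) ^ r * z \<in> J (Suc i)"
    using assms unfolding regular_chain_def by (metis nth_Cons_Suc)+
qed

lemma regular_chain_first:
  assumes "regular_chain C J (f # fs)" "y \<in> C - J 0"
  shows "\<exists>u\<in>C. \<exists>z\<in>C - J (Suc 0). \<exists>r. u * y - f ^ r * z \<in> J 0"
proof -
  have "0 < length (f # fs)" by simp
  with assms show ?thesis unfolding regular_chain_def by (metis nth_Cons_0)
qed

text \<open>
  A regular sequence is algebraically independent over a field of constants, even after
  multiplication by an arbitrary \<open>y \<notin> J 0\<close>. By induction: write the polynomial as a power \<open>f ^ s\<close> of
  the first element times a polynomial with nonzero value at \<open>f = 0\<close>, and write a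
  multiple of \<open>y\<close> as \<open>f ^ r * z\<close> modulo \<open>J 0\<close>, with \<open>z \<notin> J (Suc 0)\<close>. Since \<open>f\<close> is regular, the factor \<open>f ^ (r + s)\<close> can be cancelled, and the remaining
  factors are treated modulo \<open>J (Suc 0)\<close>. The map \<open>h\<close> embeds the field;
  its additivity is not needed.
\<close>
lemma regular_chain_independent:
  fixes h :: "'k::field \<Rightarrow> 'r::comm_ring_1"
  assumes C: "subring_set C"
    and h: "\<And>c. h c \<in> C" "h 0 = 0" "h 1 = 1" "\<And>a b. h (a * b) = h a * h b"
    and chain: "regular_chain C J fs"
    and y: "y \<in> C" "y \<notin> J 0"
    and c: "\<exists>as\<in>exps (length fs) N. c as \<noteq> 0"
  shows "(\<Sum>as\<in>exps (length fs) N. h (c as) * mpow fs as) * y \<notin> J 0"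
  using chain y c
proof (induction fs arbitrary: J y c)
  case Nil
  have ex: "exps 0 N = {[]}" by (auto simp: exps_def)
  have id: "ideal_of C (J 0)" using Nil.prems by (simp add: regular_chain_def)
  have "c [] \<noteq> 0" using Nil.prems(4) by (simp add: ex)
  then have inv: "h (1 / c []) * h (c []) = 1" using h(3) h(4)[of "1 / c []" "c []"] by simp
  show ?case
  proof
    assume "(\<Sum>as\<in>exps (length []) N. h (c as) * mpow [] as) * y \<in> J 0"
    then have "h (c []) * y \<in> J 0" by (simp add: ex)
    then have "h (1 / c []) * (h (c []) * y) \<in> J 0" using ideal_ofD(4)[OF C id] h(1) by blast
    then have "y \<in> J 0" using inv by (simp flip: mult.assoc)
    then show False using Nil.prems by simp
  qed
next
  case (Cons f fs)
  let ?d = "length fs"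
  have id: "ideal_of C (J 0)" "ideal_of C (J (Suc 0))"
    and sub: "J 0 \<subseteq> J (Suc 0)" and fJ: "f \<in> J (Suc 0)"
    and reg: "\<And>g. g \<in> C \<Longrightarrow> f * g \<in> J 0 \<Longrightarrow> g \<in> J 0"
    and fC: "f \<in> C" "set fs \<subseteq> C"
    using Cons.prems(1) unfolding regular_chain_def by force+
  obtain u z r where uz: "u \<in> C" "z \<in> C" "z \<notin> J (Suc 0)" "u * y - f ^ r * z \<in> J 0"
    using Cons.prems(2,3) regular_chain_first[OF Cons.prems(1)] by blast
  have reg_pow: "g \<in> J 0" if "f ^ n * g \<in> J 0" "g \<in> C" for n g
    using that
  proof (induction n)
    case (Suc n)
    have "f ^ n * g \<in> C" using fC(1) Suc.prems(2) C by (simp add: subring_setD)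
    moreover have "f * (f ^ n * g) \<in> J 0" using Suc.prems(1) by (simp add: mult.assoc)
    ultimately show ?case using reg Suc by blast
  qed simp
  define S where "S a = (\<Sum>as\<in>exps ?d N. h (c (a # as)) * mpow fs as)" for a
  have SC: "S a \<in> C" for a
    unfolding S_def using C h(1) fC(2) by (intro subring_set_sum) (auto simp: subring_setD mpow_closed)
  let ?P = "\<Sum>as\<in>exps (length (f # fs)) N. h (c as) * mpow (f # fs) as"
  have P: "?P = (\<Sum>a<N. f ^ a * S a)"
    by (simp add: sum_exps_Suc S_def sum_distrib_left mult.left_commute)
  \<comment> \<open>\<open>s\<close> is the exact power of \<open>f\<close> that divides the polynomial\<close>
  define s where "s = (LEAST a. \<exists>as\<in>exps ?d N. c (a # as) \<noteq> 0)"
  obtain a0 as0 where a0: "a0 < N" "as0 \<in> exps ?d N" "c (a0 # as0) \<noteq> 0"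
    using Cons.prems(4) by (auto simp: exps_def length_Suc_conv)
  have s: "\<exists>as\<in>exps ?d N. c (s # as) \<noteq> 0"
    unfolding s_def by (rule LeastI_ex) (use a0 in blast)
  have "s \<le> a0" unfolding s_def by (rule Least_le) (use a0 in blast)
  then have sN: "s < N" using a0 by simp
  have "S a = 0" if "a < s" for a
    using not_less_Least[OF that[unfolded s_def]] h(2) by (simp add: S_def)
  moreover obtain M where M: "N = s + Suc M" using sN less_iff_Suc_add by auto
  ultimately have "(\<Sum>a<N. f ^ a * S a) = (\<Sum>a\<in>{s..<N}. f ^ a * S a)"
    by (intro sum.mono_neutral_right) auto
  also have "\<dots> = (\<Sum>a<Suc M. f ^ (s + a) * S (s + a))"
    using sum.shift_bounds_nat_ivl[of "\<lambda>a. f ^ a * S a" 0 s "Suc M"] M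
    by (simp add: lessThan_atLeast0 add.commute)
  also have "\<dots> = f ^ s * (\<Sum>a<Suc M. f ^ a * S (s + a))"
    by (simp only: sum_distrib_left power_add mult.assoc)
  also have "(\<Sum>a<Suc M. f ^ a * S (s + a)) = S s + f * (\<Sum>a<M. f ^ a * S (s + Suc a))"
    by (subst sum.lessThan_Suc_shift) (simp add: sum_distrib_left mult.assoc)
  finally obtain Z where Z: "?P = f ^ s * (S s + f * Z)" "Z = (\<Sum>a<M. f ^ a * S (s + Suc a))"
    using P by simp
  have ZC: "Z \<in> C"
    unfolding Z(2) using C fC(1) SC by (intro subring_set_sum) (auto simp: subring_setD)
  show ?case
  proof
    assume "?P * y \<in> J 0"
    then have "u * (?P * y) \<in> J 0" using ideal_ofD(4)[OF C id(1)] uz(1) by blast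
    moreover have "?P * (u * y - f ^ r * z) \<in> J 0"
    proof -
      have "?P \<in> C" unfolding Z(1) using C fC(1) SC ZC by (simp add: subring_setD)
      then show ?thesis using ideal_ofD(4)[OF C id(1)] uz(4) by blast
    qed
    ultimately have "u * (?P * y) - ?P * (u * y - f ^ r * z) \<in> J 0"
      using ideal_ofD(6)[OF C id(1)] by blast
    moreover have "u * (?P * y) - ?P * (u * y - f ^ r * z) = f ^ (r + s) * ((S s + f * Z) * z)"
      unfolding Z(1) by (simp add: algebra_simps power_add)
    ultimately have "(S s + f * Z) * z \<in> J 0"
      using reg_pow C fC(1) SC ZC uz(2) by (simp add: subring_setD)
    then have "(S s + f * Z) * z \<in> J (Suc 0)" using sub by blast
    moreover have "(Z * z) * f \<in> J (Suc 0)"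
      using ideal_ofD(4)[OF C id(2) _ fJ] C ZC uz(2) by (simp add: subring_setD)
    ultimately have "(S s + f * Z) * z - (Z * z) * f \<in> J (Suc 0)"
      using ideal_ofD(6)[OF C id(2)] by blast
    then have "S s * z \<in> J (Suc 0)" by (simp add: algebra_simps)
    moreover have "S s * z \<notin> J (Suc 0)"
      unfolding S_def
      by (rule Cons.IH[OF regular_chain_tail[OF Cons.prems(1)] uz(2,3), where c = "\<lambda>as. c (s # as)"]) (rule s)
    ultimately show False by simp
  qed
qed

section \<open>Local rings of fractions\<close>

lemma (in cring) mem_add_cgenideal:
  assumes "y \<in> carrier R"
  shows "a \<in> J <+>\<^bsub>R\<^esub> PIdl y \<longleftrightarrow> (\<exists>j\<in>J. \<exists>b\<in>carrier R. a = j \<oplus> b \<otimes> y)"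
  by (auto simp: set_add_def' cgenideal_def)

text \<open>
  Krull's intersection theorem for one element \<open>x\<close> of the Jacobson radical that is regular modulo
  \<open>J\<close>. Write \<open>y\<close> as \<open>b x ^ (n + 1)\<close> modulo \<open>J\<close>, where \<open>n\<close> is an index from which on the ascending chain of
  the ideals \<open>{a. x ^ n a \<in> J + (y)}\<close> is constant. As \<open>b\<close> lies in the \<open>(n + 1)\<close>st of these ideals, it
  lies in the \<open>n\<close>th, and comparison gives \<open>x ^ n b (1 - e x) \<in> J\<close> for some \<open>e\<close>.
\<close>
lemma (in cring) regular_element_intersection:
  assumes noeth: "noetherian_ring R" and J: "ideal J R" and x: "x \<in> carrier R"
    and jac: "\<And>b. b \<in> carrier R \<Longrightarrow> \<one> \<ominus> b \<otimes> x \<in> Units R"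
    and reg: "\<And>a. a \<in> carrier R \<Longrightarrow> x \<otimes> a \<in> J \<Longrightarrow> a \<in> J"
    and y: "y \<in> carrier R" and all: "\<And>n::nat. y \<in> J <+>\<^bsub>R\<^esub> PIdl (x [^] n)"
  shows "y \<in> J"
proof -
  interpret J: ideal J R by (rule J)
  interpret N: noetherian_ring R by (rule noeth)
  have reg_pow: "a \<in> J" if "a \<in> carrier R" "x [^] n \<otimes> a \<in> J" for a and n :: nat
    using that
  proof (induction n)
    case (Suc n)
    have "x \<otimes> (x [^] n \<otimes> a) = x [^] Suc n \<otimes> a"
      using x Suc.prems(1) by (simp add: m_ac)
    then show ?case using Suc reg[of "x [^] n \<otimes> a"] x by simp
  qed simp
  define K where "K = J <+>\<^bsub>R\<^esub> PIdl y"
  have K: "ideal K R" unfolding K_def by (rule add_ideals[OF J cgenideal_ideal[OF y]])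
  interpret K: ideal K R by (rule K)
  define D where "D n = {a \<in> carrier R. x [^] n \<otimes> a \<in> K}" for n :: nat
  have D: "ideal (D n) R" for n
    unfolding D_def by (rule K.helper_max_prime[OF is_cring]) (use x in simp)
  have step: "D n \<subseteq> D (Suc n)" for n
  proof
    fix a assume "a \<in> D n"
    then have a: "a \<in> carrier R" "x [^] n \<otimes> a \<in> K" by (auto simp: D_def)
    have "x [^] Suc n \<otimes> a = x \<otimes> (x [^] n \<otimes> a)" using a(1) x by (simp add: m_ac)
    also have "\<dots> \<in> K" using a(2) x K.I_l_closed by simp
    finally show "a \<in> D (Suc n)" using a(1) by (simp add: D_def)
  qed
  have mono: "D m \<subseteq> D n" if "m \<le> n" for m n
    by (rule lift_Suc_mono_le[of D]) (use step that in auto)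
  have "subset.chain {I. ideal I R} (range D)"
    unfolding subset_chain_def
  proof (intro conjI ballI)
    fix X Y assume "X \<in> range D" "Y \<in> range D"
    then obtain m n where "X = D m" "Y = D n" by blast
    then show "X \<subseteq> Y \<or> Y \<subseteq> X" using mono[of m n] mono[of n m] nat_le_linear[of m n] by blast
  qed (use D in blast)
  then have "\<Union>(range D) \<in> range D" by (intro N.ideal_chain_is_trivial) auto
  then obtain n where n: "\<Union>(range D) = D n" by blast
  obtain j b where jb: "j \<in> J" "b \<in> carrier R" "y = j \<oplus> b \<otimes> x [^] Suc n"
    using all[of "Suc n"] x unfolding mem_add_cgenideal[OF nat_pow_closed[OF x]] by blast
  have yK: "y \<in> K"
    unfolding K_def mem_add_cgenideal[OF y] by (rule bexI[of _ \<zero>], rule bexI[of _ \<one>]) (use y in auto)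
  have jK: "j \<in> K"
    unfolding K_def mem_add_cgenideal[OF y]
    by (rule bexI[OF _ jb(1)], rule bexI[of _ \<zero>]) (use y jb(1) J.a_Hcarr in auto)
  have jc: "j \<in> carrier R" using jb(1) J.a_Hcarr by blast
  have "x [^] Suc n \<otimes> b = y \<ominus> j"
    unfolding jb(3) using jc jb(2) nat_pow_closed[OF x, of "Suc n"] by algebra
  also have "\<dots> \<in> K" using yK jK by (simp add: a_minus_def)
  finally have "b \<in> D (Suc n)" using jb(2) by (simp add: D_def)
  then have "b \<in> D n" using n by blast
  then have "x [^] n \<otimes> b \<in> K" by (simp add: D_def)
  then obtain i e where ie: "i \<in> J" "e \<in> carrier R" "x [^] n \<otimes> b = i \<oplus> e \<otimes> y"
    unfolding K_def mem_add_cgenideal[OF y] by blast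
  have ic: "i \<in> carrier R" using ie(1) J.a_Hcarr by blast
  let ?v = "\<one> \<ominus> e \<otimes> x"
  have vU: "?v \<in> Units R" using jac ie(2) by simp
  have vC: "?v \<in> carrier R" using vU by (rule Units_closed)
  have j2: "i \<oplus> e \<otimes> j \<in> J" using ie(1,2) jb(1) J.I_l_closed by simp
  have "x [^] n \<otimes> (b \<otimes> ?v) = x [^] n \<otimes> b \<ominus> e \<otimes> (b \<otimes> x [^] Suc n)"
  proof -
    have "x [^] n \<otimes> (b \<otimes> (\<one> \<ominus> e \<otimes> x)) = x [^] n \<otimes> b \<ominus> e \<otimes> (b \<otimes> (x [^] n \<otimes> x))"
      if "x [^] n \<in> carrier R"
      using jb(2) ie(2) x that by algebra
    then show ?thesis using x by simp
  qed
  also have "\<dots> = i \<oplus> e \<otimes> j"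
  proof -
    let ?p = "b \<otimes> x [^] Suc n"
    have pc: "?p \<in> carrier R" using jb(2) x by simp
    have "x [^] n \<otimes> b = i \<oplus> e \<otimes> (j \<oplus> ?p)" using ie(3) jb(3) by simp
    then show ?thesis using ic jc ie(2) pc by algebra
  qed
  finally have "x [^] n \<otimes> (b \<otimes> ?v) \<in> J" using j2 by simp
  then have "b \<otimes> ?v \<in> J" using reg_pow[of "b \<otimes> ?v" n] jb(2) vC by simp
  then have "(b \<otimes> ?v) \<otimes> inv ?v \<in> J" using J.I_r_closed vU by simp
  moreover have "(b \<otimes> ?v) \<otimes> inv ?v = b" using jb(2) vU vC by (simp add: m_assoc)
  ultimately have "b \<in> J" by simp
  then have "b \<otimes> x [^] Suc n \<in> J" using J.I_r_closed x by simp
  then show ?thesis unfolding jb(3) using jb(1) J.a_closed by blast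
qed

text \<open>
  A Noetherian ring \<open>A\<close> presented as fractions \<open>\<phi> p s\<close> with numerators in a subring \<open>C\<close> of an
  ambient ring, denominators in \<open>U\<close>, and relations from an ideal \<open>I\<close> of \<open>C\<close>; that is, \<open>A\<close> is the
  localization of \<open>C / I\<close> at the image of \<open>U\<close>. By the conditions \<open>nonU_mult\<close> and \<open>U_add\<close>,
  \<open>A\<close> is local unless it is zero, and each element of its maximal ideal has a numerator in \<open>C - U\<close>.
\<close>
locale local_fractions = cring A for A :: "('a, 'm) ring_scheme" (structure) +
  fixes C U I :: "'r::comm_ring_1 set" and \<phi> :: "'r \<Rightarrow> 'r \<Rightarrow> 'a"
  assumes noeth: "noetherian_ring A"
    and C: "subring_set C" and I: "ideal_of C I"
    and U_sub: "U \<subseteq> C" and U_one: "1 \<in> U" and U_mult: "\<And>s t. s \<in> U \<Longrightarrow> t \<in> U \<Longrightarrow> s * t \<in> U"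
    and nonU_mult: "\<And>c p. c \<in> C \<Longrightarrow> p \<in> C - U \<Longrightarrow> c * p \<notin> U"
    and U_add: "\<And>s p. s \<in> U \<Longrightarrow> p \<in> C - U \<Longrightarrow> s + p \<in> U"
    and carrier_eq: "carrier A = {\<phi> p s | p s. p \<in> C \<and> s \<in> U}"
    and eq_iff: "\<And>p s q t. p \<in> C \<Longrightarrow> s \<in> U \<Longrightarrow> q \<in> C \<Longrightarrow> t \<in> U \<Longrightarrow>
        \<phi> p s = \<phi> q t \<longleftrightarrow> (\<exists>u\<in>U. u * (p * t - q * s) \<in> I)"
    and mult_eq: "\<And>p s q t. p \<in> C \<Longrightarrow> s \<in> U \<Longrightarrow> q \<in> C \<Longrightarrow> t \<in> U \<Longrightarrow>
        \<phi> p s \<otimes> \<phi> q t = \<phi> (p * q) (s * t)"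
    and add_eq: "\<And>p s q t. p \<in> C \<Longrightarrow> s \<in> U \<Longrightarrow> q \<in> C \<Longrightarrow> t \<in> U \<Longrightarrow>
        \<phi> p s \<oplus> \<phi> q t = \<phi> (p * t + q * s) (s * t)"
    and one_eq: "\<one> = \<phi> 1 1" and zero_eq: "\<zero> = \<phi> 0 1"
begin

lemmas C_closed = subring_setD[OF C]
lemmas I_closed = ideal_ofD[OF C I]

lemma UC: "s \<in> U \<Longrightarrow> s \<in> C"
  using U_sub by blast

lemma phi_closed [simp]: "p \<in> C \<Longrightarrow> s \<in> U \<Longrightarrow> \<phi> p s \<in> carrier A"
  using carrier_eq by blast

lemma phi_cases:
  assumes "x \<in> carrier A"
  obtains p s where "p \<in> C" "s \<in> U" "x = \<phi> p s"
  using assms carrier_eq by blast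

lemma phi_eqI:
  assumes "p \<in> C" "s \<in> U" "q \<in> C" "t \<in> U" "p * t = q * s"
  shows "\<phi> p s = \<phi> q t"
  unfolding eq_iff[OF assms(1-4)] by (rule bexI[OF _ U_one]) (use assms(5) I_closed(2) in simp)

lemma phi_one: "s \<in> U \<Longrightarrow> \<phi> s s = \<one>"
  unfolding one_eq by (rule phi_eqI) (use UC U_one C_closed in auto)

lemma phi_inverse:
  assumes "s \<in> U" "t \<in> U"
  shows "\<phi> t s \<otimes> \<phi> s t = \<one>"
  using assms by (simp add: mult_eq UC mult.commute[of t s] phi_one U_mult)

lemma phi_Units: "s \<in> U \<Longrightarrow> t \<in> U \<Longrightarrow> \<phi> s t \<in> Units A"
  using phi_inverse phi_closed UC unfolding Units_def by blast

lemma phi_split: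
  assumes "p \<in> C" "s \<in> U"
  shows "\<phi> p s = \<phi> 1 s \<otimes> \<phi> p 1" "\<phi> p 1 = \<phi> s 1 \<otimes> \<phi> p s"
  using assms by (auto simp: mult_eq C_closed U_one UC U_mult intro!: phi_eqI)

lemma phi_diff:
  assumes "p \<in> C" "q \<in> C" "s \<in> U"
  shows "\<phi> p s \<ominus> \<phi> q s = \<phi> (p - q) s"
proof -
  have sum: "\<phi> (p - q) s \<oplus> \<phi> q s = \<phi> p s"
    unfolding add_eq[OF C_closed(4)[OF assms(1,2)] assms(3) assms(2,3)]
    by (rule phi_eqI) (use assms in \<open>auto simp: C_closed UC U_mult algebra_simps\<close>)
  have "\<phi> (p - q) s \<in> carrier A" "\<phi> q s \<in> carrier A"
    using assms C_closed by auto
  then have "(\<phi> (p - q) s \<oplus> \<phi> q s) \<ominus> \<phi> q s = \<phi> (p - q) s" by algebra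
  then show ?thesis by (simp only: sum)
qed

lemma U_pow: "s \<in> U \<Longrightarrow> s ^ n \<in> U"
  using U_one U_mult by (induction n) auto

lemma phi_pow: "p \<in> C \<Longrightarrow> s \<in> U \<Longrightarrow> \<phi> p s [^] (n::nat) = \<phi> (p ^ n) (s ^ n)"
proof (induction n)
  case 0
  then show ?case by (simp add: one_eq)
next
  case (Suc n)
  then show ?case using U_pow[of s n] by (simp add: mult_eq C_closed mult.commute)
qed

lemma maximalideal_member:
  assumes "maximalideal M A" "x \<in> M"
  obtains f s where "f \<in> C - U" "s \<in> U" "x = \<phi> f s"
proof -
  interpret M: maximalideal M A by fact
  obtain f s where fs: "f \<in> C" "s \<in> U" "x = \<phi> f s"
    using phi_cases M.a_Hcarr assms(2) by blast
  have "f \<notin> U"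
  proof
    assume "f \<in> U"
    then have "\<phi> s f \<otimes> x \<in> M" using M.I_l_closed assms(2) fs UC by simp
    then have "\<one> \<in> M" using phi_inverse[OF \<open>f \<in> U\<close> fs(2)] fs(3) by simp
    then show False using M.one_imp_carrier M.I_notcarr by blast
  qed
  then show ?thesis using that fs by blast
qed

lemma one_minus_Units:
  assumes "f \<in> C - U" "s \<in> U" "b \<in> carrier A"
  shows "\<one> \<ominus> b \<otimes> \<phi> f s \<in> Units A"
proof -
  obtain p t where pt: "p \<in> C" "t \<in> U" "b = \<phi> p t" using phi_cases assms(3) by blast
  have st: "t * s \<in> U" using pt assms U_mult by blast
  have pf: "p * f \<in> C" "p * f \<notin> U" using pt(1) assms(1) C_closed nonU_mult by auto
  have "- 1 * (p * f) \<notin> U" using nonU_mult[of "- 1" "p * f"] pf C_closed by auto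
  then have "t * s + (- (p * f)) \<in> U" using pf C_closed by (intro U_add[OF st]) auto
  moreover have "\<one> \<ominus> b \<otimes> \<phi> f s = \<phi> (t * s - p * f) (t * s)"
    using phi_diff[OF UC[OF st] pf(1) st] phi_one[OF st] pt assms(1,2) by (simp add: mult_eq)
  ultimately show ?thesis using phi_Units st by simp
qed

lemma genideal_take_Suc:
  assumes "set xs \<subseteq> carrier A" "i < length xs"
  shows "genideal A (set (take (Suc i) xs)) \<subseteq> genideal A (set (take i xs)) <+>\<^bsub>A\<^esub> PIdl (xs ! i)"
proof -
  have x: "xs ! i \<in> carrier A" using assms by auto
  have t: "set (take i xs) \<subseteq> carrier A" using assms(1) set_take_subset[of i xs] by blast
  have K: "ideal (genideal A (set (take i xs))) A" by (rule genideal_ideal[OF t])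
  have "a \<in> genideal A (set (take i xs)) <+>\<^bsub>A\<^esub> PIdl (xs ! i)" if "a \<in> set (take (Suc i) xs)" for a
  proof -
    have "a = xs ! i \<or> a \<in> set (take i xs)"
      using that assms(2) by (auto simp: take_Suc_conv_app_nth)
    then show ?thesis
    proof
      assume a: "a = xs ! i"
      show ?thesis
        unfolding mem_add_cgenideal[OF x] a
        by (rule bexI[of _ \<zero>], rule bexI[of _ \<one>])
          (use x additive_subgroup.zero_closed[OF ideal.axioms(1)[OF K]] in auto)
    next
      assume a: "a \<in> set (take i xs)"
      show ?thesis
        unfolding mem_add_cgenideal[OF x]
        by (rule bexI[of _ a], rule bexI[of _ \<zero>]) (use x a t genideal_self[OF t] in auto)
    qed
  qed
  then show ?thesis
    by (intro genideal_minimal add_ideals K cgenideal_ideal x) auto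
qed

text \<open>
  A regular sequence in a maximal ideal is replaced by numerators of its members, which differ from
  them by units.
\<close>
lemma regular_sequence_pullback:
  assumes reg: "regular_sequence A xs" and M: "maximalideal M A" "set xs \<subseteq> M"
  obtains J fs where "length fs = length xs" "regular_chain C J fs"
    "J 0 = {p \<in> C. \<exists>u\<in>U. u * p \<in> I}"
proof -
  have xsC: "set xs \<subseteq> carrier A"
    and regular: "\<And>i a. i < length xs \<Longrightarrow> a \<in> carrier A \<Longrightarrow>
        xs ! i \<otimes> a \<in> genideal A (set (take i xs)) \<Longrightarrow> a \<in> genideal A (set (take i xs))"
    using reg by (auto simp: regular_sequence_def)
  define K where "K i = genideal A (set (take i xs))" for i
  have K: "ideal (K i) A" for i
    unfolding K_def using xsC set_take_subset[of i xs] by (intro genideal_ideal) blast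
  have K_Suc: "K (Suc i) \<subseteq> K i <+>\<^bsub>A\<^esub> PIdl (xs ! i)" if "i < length xs" for i
    unfolding K_def by (rule genideal_take_Suc[OF xsC that])
  have "\<forall>x\<in>set xs. \<exists>f s. f \<in> C - U \<and> s \<in> U \<and> x = \<phi> f s"
    using maximalideal_member[OF M(1)] M(2) by (metis subsetD)
  then obtain f s where fs: "\<And>x. x \<in> set xs \<Longrightarrow> f x \<in> C - U \<and> s x \<in> U \<and> x = \<phi> (f x) (s x)"
    by metis
  have nth: "f (xs ! i) \<in> C - U" "s (xs ! i) \<in> U" "xs ! i = \<phi> (f (xs ! i)) (s (xs ! i))"
    if "i < length xs" for i using fs that by auto
  define J where "J i = {p \<in> C. \<phi> p 1 \<in> K i}" for i
  have J_phi: "p \<in> J i \<longleftrightarrow> \<phi> p t \<in> K i" if "p \<in> C" "t \<in> U" for p t i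
  proof
    interpret K: ideal "K i" A by (rule K)
    show "p \<in> J i \<Longrightarrow> \<phi> p t \<in> K i"
      using phi_split(1)[OF that] that K.I_l_closed C_closed(1) by (simp add: J_def)
    show "\<phi> p t \<in> K i \<Longrightarrow> p \<in> J i"
      using phi_split(2)[OF that] that K.I_l_closed U_one UC by (simp add: J_def)
  qed
  have J_ideal: "ideal_of C (J i)" for i
  proof -
    interpret K: ideal "K i" A by (rule K)
    have "p + q \<in> J i" if "p \<in> J i" "q \<in> J i" for p q
      using that K.a_closed[of "\<phi> p 1" "\<phi> q 1"] U_one C_closed by (simp add: J_def add_eq)
    moreover have "c * p \<in> J i" if "c \<in> C" "p \<in> J i" for c p
      using that K.I_l_closed[of "\<phi> p 1" "\<phi> c 1"] U_one C_closed by (simp add: J_def mult_eq)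
    moreover have "0 \<in> J i" using K.zero_closed C_closed by (simp add: J_def flip: zero_eq)
    ultimately show ?thesis by (auto simp: ideal_of_def J_def)
  qed
  have "regular_chain C J (map f xs)"
    unfolding regular_chain_def length_map
  proof (intro conjI allI impI ballI)
    show "set (map f xs) \<subseteq> C" using fs by auto
    show "ideal_of C (J i)" for i by (rule J_ideal)
    fix i assume i: "i < length xs"
    let ?x = "xs ! i" and ?f = "map f xs ! i"
    have f: "?f \<in> C - U" "?f = f ?x" and x: "?x = \<phi> ?f (s ?x)" and sx: "s ?x \<in> U"
      using nth[OF i] i by auto
    have xA: "?x \<in> carrier A" using xsC i by auto
    interpret K: ideal "K i" A by (rule K)
    have "K i \<subseteq> K (Suc i)" "?x \<in> K (Suc i)"
    proof -
      have "set (take (Suc i) xs) \<subseteq> carrier A" using xsC set_take_subset[of "Suc i" xs] by blast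
      then have sub: "set (take (Suc i) xs) \<subseteq> K (Suc i)" unfolding K_def by (rule genideal_self)
      then show "K i \<subseteq> K (Suc i)"
        using set_take_subset_set_take[of i "Suc i" xs] genideal_minimal[OF K, of "set (take i xs)" "Suc i"]
        unfolding K_def by auto
      show "?x \<in> K (Suc i)" using sub i by (simp add: take_Suc_conv_app_nth)
    qed
    then show "J i \<subseteq> J (Suc i)" "?f \<in> J (Suc i)"
      using J_phi[of ?f "s ?x" "Suc i"] f(1) sx x by (auto simp: J_def)
    show "g \<in> J i" if "g \<in> C" "?f * g \<in> J i" for g
    proof -
      have "\<phi> (?f * g) (s ?x * 1) \<in> K i"
        using J_phi[of "?f * g" "s ?x" i] that f(1) sx C_closed by simp
      then have "?x \<otimes> \<phi> g 1 \<in> K i"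
        using mult_eq[of ?f "s ?x" g 1] x that(1) f(1) sx U_one by simp
      then have "\<phi> g 1 \<in> K i"
        using regular[OF i, of "\<phi> g 1"] that(1) U_one by (simp add: K_def)
      then show ?thesis using that(1) by (simp add: J_def)
    qed
    fix y assume y: "y \<in> C - J i"
    let ?y = "\<phi> y 1"
    have yA: "?y \<in> carrier A" "?y \<notin> K i" using y U_one by (auto simp: J_def)
    \<comment> \<open>there is a largest exponent \<open>r\<close> such that \<open>y\<close> lies in \<open>K i + (x ^ r)\<close>\<close>
    have "\<not> (\<forall>n::nat. ?y \<in> K i <+>\<^bsub>A\<^esub> PIdl (?x [^] n))"
    proof
      assume all: "\<forall>n::nat. ?y \<in> K i <+>\<^bsub>A\<^esub> PIdl (?x [^] n)"
      have "?y \<in> K i"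
      proof (rule regular_element_intersection[OF noeth K xA _ _ yA(1)])
        show "\<one> \<ominus> b \<otimes> ?x \<in> Units A" if "b \<in> carrier A" for b
          using one_minus_Units[OF f(1) sx that] x by simp
        show "a \<in> K i" if "a \<in> carrier A" "?x \<otimes> a \<in> K i" for a
          using regular[OF i] that by (simp add: K_def)
      qed (use all in blast)
      then show False using yA(2) by simp
    qed
    moreover have "?y \<in> K i <+>\<^bsub>A\<^esub> PIdl (?x [^] (0::nat))"
      unfolding mem_add_cgenideal[OF nat_pow_closed[OF xA]]
      by (rule bexI[of _ \<zero>], rule bexI[of _ ?y]) (use yA K.zero_closed in auto)
    ultimately obtain r where r: "?y \<in> K i <+>\<^bsub>A\<^esub> PIdl (?x [^] (r::nat))"
        "?y \<notin> K i <+>\<^bsub>A\<^esub> PIdl (?x [^] Suc r)"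
      using nat_induct[of "\<lambda>n. ?y \<in> K i <+>\<^bsub>A\<^esub> PIdl (?x [^] n)"] by blast
    obtain j z where jz: "j \<in> K i" "z \<in> carrier A" "?y = j \<oplus> z \<otimes> ?x [^] r"
      using r(1) mem_add_cgenideal[of "?x [^] r"] xA by auto
    have jA: "j \<in> carrier A" using jz(1) K.a_Hcarr by blast
    have znot: "z \<notin> K (Suc i)"
    proof
      assume "z \<in> K (Suc i)"
      then have "z \<in> K i <+>\<^bsub>A\<^esub> PIdl ?x" using K_Suc[OF i] by blast
      then obtain l b where lb: "l \<in> K i" "b \<in> carrier A" "z = l \<oplus> b \<otimes> ?x"
        unfolding mem_add_cgenideal[OF xA] by blast
      have lA: "l \<in> carrier A" using lb(1) K.a_Hcarr by blast
      have xr: "?x [^] r \<in> carrier A" using xA by simp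
      have "?y = (j \<oplus> l \<otimes> ?x [^] r) \<oplus> b \<otimes> (?x [^] r \<otimes> ?x)"
        unfolding jz(3) lb(3) using jA lA lb(2) xA xr by algebra
      then have "?y = (j \<oplus> l \<otimes> ?x [^] r) \<oplus> b \<otimes> ?x [^] Suc r" by simp
      moreover have "j \<oplus> l \<otimes> ?x [^] r \<in> K i" using jz(1) lb(1) K.I_r_closed xr by simp
      ultimately have "?y \<in> K i <+>\<^bsub>A\<^esub> PIdl (?x [^] Suc r)"
        using mem_add_cgenideal[of "?x [^] Suc r"] xA lb(2) by blast
      then show False using r(2) by simp
    qed
    obtain q t where qt: "q \<in> C" "t \<in> U" "z = \<phi> q t" using phi_cases jz(2) by blast
    have qJ: "q \<in> C - J (Suc i)" using znot J_phi[OF qt(1,2)] qt by simp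
    let ?u = "t * s ?x ^ r"
    have uU: "?u \<in> U" using qt(2) sx U_pow U_mult by simp
    have "z \<otimes> ?x [^] r = \<phi> (q * ?f ^ r) ?u"
    proof -
      have "?x [^] r = \<phi> (?f ^ r) (s ?x ^ r)" using phi_pow[of ?f "s ?x" r] x f(1) sx by simp
      then show ?thesis using qt mult_eq f(1) sx C_closed U_pow by simp
    qed
    moreover have "?y \<ominus> z \<otimes> ?x [^] r = j"
      unfolding jz(3) using jA jz(2) nat_pow_closed[OF xA, of r] by algebra
    moreover have "?y = \<phi> (?u * y) ?u"
      by (rule phi_eqI) (use y uU U_one UC C_closed in \<open>auto simp: mult.commute\<close>)
    ultimately have "\<phi> (?u * y - q * ?f ^ r) ?u \<in> K i"
      using phi_diff[of "?u * y" "q * ?f ^ r" ?u] uU UC y qt(1) f(1) C_closed jz(1) by simp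
    then have "?u * y - q * ?f ^ r \<in> J i"
      using J_phi[of "?u * y - q * ?f ^ r" ?u i] uU UC y qt(1) f(1) C_closed by simp
    then have "?u * y - ?f ^ r * q \<in> J i" by (simp add: mult.commute)
    then show "\<exists>u\<in>C. \<exists>z\<in>C - J (Suc i). \<exists>r. u * y - ?f ^ r * z \<in> J i"
      using qJ UC[OF uU] by blast
  qed
  moreover have "J 0 = {p \<in> C. \<exists>u\<in>U. u * p \<in> I}"
  proof -
    have "K 0 = {\<zero>}"
    proof
      show "K 0 \<subseteq> {\<zero>}" unfolding K_def by (rule genideal_minimal[OF zeroideal]) simp
      show "{\<zero>} \<subseteq> K 0" using additive_subgroup.zero_closed[OF ideal.axioms(1)[OF K]] by simp
    qed
    then have "J 0 = {p \<in> C. \<phi> p 1 = \<phi> 0 1}" by (simp add: J_def zero_eq)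
    then show ?thesis using eq_iff U_one C_closed by auto
  qed
  ultimately show ?thesis using that[of "map f xs" J] by simp
qed

text \<open>
  A prime of \<open>C\<close> that contains \<open>I\<close> and misses \<open>U\<close> extends to a prime of \<open>A\<close>, from which it is
  recovered.
\<close>
lemma primeideal_fractions:
  assumes P: "ideal_of C P" "I \<subseteq> P" "P \<inter> U = {}"
    and prime: "\<And>p q. p \<in> C \<Longrightarrow> q \<in> C \<Longrightarrow> p * q \<in> P \<Longrightarrow> p \<in> P \<or> q \<in> P"
  shows "primeideal {x. \<exists>p\<in>P. \<exists>s\<in>U. x = \<phi> p s} A"
    and "p \<in> C \<Longrightarrow> s \<in> U \<Longrightarrow> \<phi> p s \<in> {x. \<exists>p\<in>P. \<exists>s\<in>U. x = \<phi> p s} \<longleftrightarrow> p \<in> P"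
proof -
  let ?Q = "{x. \<exists>p\<in>P. \<exists>s\<in>U. x = \<phi> p s}"
  note Pc = ideal_ofD[OF C P(1)]
  have PC: "p \<in> P \<Longrightarrow> p \<in> C" for p using Pc(1) by blast
  have mem: "\<phi> p s \<in> ?Q \<longleftrightarrow> p \<in> P" if ps: "p \<in> C" "s \<in> U" for p s
  proof
    assume "\<phi> p s \<in> ?Q"
    then obtain q t where qt: "q \<in> P" "t \<in> U" "\<phi> p s = \<phi> q t" by blast
    then obtain u where u: "u \<in> U" "u * (p * t - q * s) \<in> I"
      using eq_iff ps PC by blast
    then have "u * (p * t - q * s) \<in> P" using P(2) by blast
    moreover have "p * t - q * s \<in> C" using ps qt UC PC C_closed by simp
    ultimately have "p * t - q * s \<in> P" using prime u(1) UC P(3) by blast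
    moreover have "q * s \<in> P" using qt(1) ps(2) UC Pc(5) by blast
    ultimately have "p * t - q * s + q * s \<in> P" using Pc(3) by blast
    then have "p * t \<in> P" by simp
    then show "p \<in> P" using prime ps(1) qt(2) UC P(3) by blast
  qed (use ps in blast)
  then show "p \<in> C \<Longrightarrow> s \<in> U \<Longrightarrow> \<phi> p s \<in> ?Q \<longleftrightarrow> p \<in> P" .
  have QA: "?Q \<subseteq> carrier A" using PC by auto
  have ideal: "ideal ?Q A"
  proof (rule idealI[OF ring_axioms])
    show "subgroup ?Q (add_monoid A)"
    proof (rule add.subgroupI)
      show "?Q \<subseteq> carrier A" by (rule QA)
      show "?Q \<noteq> {}" using Pc(2) U_one by blast
      fix a assume "a \<in> ?Q"
      then obtain p s where a: "p \<in> P" "s \<in> U" "a = \<phi> p s" by blast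
      have "\<ominus> a = \<zero> \<ominus> a" using a PC by (simp add: a_minus_def)
      also have "\<zero> = \<phi> 0 s"
        unfolding zero_eq by (rule phi_eqI) (use a U_one C_closed in auto)
      also have "\<phi> 0 s \<ominus> a = \<phi> (0 - p) s"
        unfolding a(3) by (rule phi_diff) (use a PC C_closed in auto)
      finally show "\<ominus> a \<in> ?Q" using a Pc(6)[OF Pc(2) a(1)] by blast
    next
      fix a b assume "a \<in> ?Q" "b \<in> ?Q"
      then obtain p s q t where ab: "p \<in> P" "s \<in> U" "a = \<phi> p s" "q \<in> P" "t \<in> U" "b = \<phi> q t" by blast
      then have "a \<oplus> b = \<phi> (p * t + q * s) (s * t)" using add_eq PC by simp
      moreover have "p * t + q * s \<in> P" "s * t \<in> U" using ab Pc UC U_mult by auto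
      ultimately show "a \<oplus> b \<in> ?Q" by blast
    qed
    fix a x assume "a \<in> ?Q" "x \<in> carrier A"
    obtain p s where a: "p \<in> P" "s \<in> U" "a = \<phi> p s" using \<open>a \<in> ?Q\<close> by blast
    obtain q t where x: "q \<in> C" "t \<in> U" "x = \<phi> q t" using phi_cases[OF \<open>x \<in> carrier A\<close>] .
    note ab = a x
    then have "x \<otimes> a = \<phi> (q * p) (t * s)" using mult_eq PC by simp
    moreover have "q * p \<in> P" "t * s \<in> U" using ab Pc UC U_mult by auto
    ultimately show xa: "x \<otimes> a \<in> ?Q" by blast
    show "a \<otimes> x \<in> ?Q"
      using xa m_comm[OF subsetD[OF QA \<open>a \<in> ?Q\<close>] \<open>x \<in> carrier A\<close>] by (simp only:)
  qed
  show "primeideal ?Q A"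
  proof (rule primeidealI[OF ideal is_cring])
    have "1 \<notin> P" using P(3) U_one by blast
    then have "\<one> \<notin> ?Q" unfolding one_eq using mem[OF C_closed(1) U_one] by simp
    then show "carrier A \<noteq> ?Q" using one_closed by blast
    fix a b assume ab: "a \<in> carrier A" "b \<in> carrier A" "a \<otimes> b \<in> ?Q"
    obtain p s where a: "p \<in> C" "s \<in> U" "a = \<phi> p s" using phi_cases[OF ab(1)] .
    obtain q t where b: "q \<in> C" "t \<in> U" "b = \<phi> q t" using phi_cases[OF ab(2)] .
    note * = a b
    then have "\<phi> (p * q) (s * t) \<in> ?Q" using ab(3) mult_eq by simp
    then have "p * q \<in> P" using mem * C_closed U_mult by simp
    then show "a \<in> ?Q \<or> b \<in> ?Q" using prime * by blast
  qed
qed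

end

section \<open>Polynomials and squarefree monomial ideals\<close>

lemma keys_add_nat: "Poly_Mapping.keys (m + n) = Poly_Mapping.keys m \<union> Poly_Mapping.keys (n :: 'v \<Rightarrow>\<^sub>0 nat)"
  by (auto simp: in_keys_iff lookup_add)

lemma poly_mapping_sum_singles:
  "p = (\<Sum>m\<in>Poly_Mapping.keys p. Poly_Mapping.single m (Poly_Mapping.lookup p m))"
proof (rule poly_mapping_eqI)
  fix k
  have "Poly_Mapping.lookup (\<Sum>m\<in>Poly_Mapping.keys p. Poly_Mapping.single m (Poly_Mapping.lookup p m)) k
      = (\<Sum>m\<in>Poly_Mapping.keys p. if m = k then Poly_Mapping.lookup p k else 0)"
    unfolding lookup_sum by (intro sum.cong) (auto simp: lookup_single when_def)
  also have "\<dots> = Poly_Mapping.lookup p k"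
    by (auto simp: in_keys_iff)
  finally show "Poly_Mapping.lookup p k = Poly_Mapping.lookup (\<Sum>m\<in>Poly_Mapping.keys p. Poly_Mapping.single m (Poly_Mapping.lookup p m)) k"
    by simp
qed

text \<open>
  If \<open>a + b\<close> arises in only one way as a sum of exponents of \<open>p\<close> and \<open>q\<close>, no cancellation can occur at
  \<open>a + b\<close>.
\<close>
lemma lookup_mult_unique:
  fixes p q :: "'m::monoid_add \<Rightarrow>\<^sub>0 'k::semiring_0"
  assumes "\<And>m n. m \<in> Poly_Mapping.keys p \<Longrightarrow> n \<in> Poly_Mapping.keys q \<Longrightarrow> m + n = a + b \<Longrightarrow> m = a \<and> n = b"
  shows "Poly_Mapping.lookup (p * q) (a + b) = Poly_Mapping.lookup p a * Poly_Mapping.lookup q b"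
proof -
  let ?l = Poly_Mapping.lookup and ?k = Poly_Mapping.keys
  have "p * q = (\<Sum>m\<in>?k p. Poly_Mapping.single m (?l p m)) * (\<Sum>n\<in>?k q. Poly_Mapping.single n (?l q n))"
    using poly_mapping_sum_singles[of p] poly_mapping_sum_singles[of q] by simp
  also have "\<dots> = (\<Sum>m\<in>?k p. \<Sum>n\<in>?k q. Poly_Mapping.single (m + n) (?l p m * ?l q n))"
    by (simp add: sum_product mult_single)
  finally have "?l (p * q) (a + b) = (\<Sum>m\<in>?k p. \<Sum>n\<in>?k q. ?l p m * ?l q n when m + n = a + b)"
    by (simp add: lookup_sum lookup_single)
  also have "\<dots> = (\<Sum>m\<in>?k p. \<Sum>n\<in>?k q. if m = a then (if n = b then ?l p a * ?l q b else 0) else 0)"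
    by (intro sum.cong refl) (use assms in \<open>auto simp: when_def\<close>)
  also have "\<dots> = (\<Sum>m\<in>?k p. if m = a then (\<Sum>n\<in>?k q. if n = b then ?l p a * ?l q b else 0) else 0)"
    by (intro sum.cong refl) auto
  also have "\<dots> = ?l p a * ?l q b"
    by (auto simp: in_keys_iff)
  finally show ?thesis .
qed

lemma lookup_const_mult:
  "Poly_Mapping.lookup (Poly_Mapping.single 0 c * p) m = c * Poly_Mapping.lookup p m"
  for p :: "'m::monoid_add \<Rightarrow>\<^sub>0 'k::semiring_0"
proof -
  have "Poly_Mapping.lookup (Poly_Mapping.single 0 c * p) (0 + m)
      = Poly_Mapping.lookup (Poly_Mapping.single 0 c :: 'm \<Rightarrow>\<^sub>0 'k) 0 * Poly_Mapping.lookup p m"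
    by (rule lookup_mult_unique) (auto split: if_splits)
  then show ?thesis by simp
qed

lemma lookup_mult_zero:
  fixes p q :: "('v, 'k::field) mpoly"
  shows "Poly_Mapping.lookup (p * q) 0 = Poly_Mapping.lookup p 0 * Poly_Mapping.lookup q 0"
proof -
  have "m = 0 \<and> n = 0" if "m + n = 0 + 0" for m n :: "'v \<Rightarrow>\<^sub>0 nat"
  proof -
    have "Poly_Mapping.keys (m + n) = {}" using that by simp
    then have "Poly_Mapping.keys m = {}" "Poly_Mapping.keys n = {}"
      unfolding keys_add_nat by auto
    then show ?thesis by simp
  qed
  then have "Poly_Mapping.lookup (p * q) (0 + 0) = Poly_Mapping.lookup p 0 * Poly_Mapping.lookup q 0"
    by (intro lookup_mult_unique)
  then show ?thesis by simp
qed

lemma mpoly_mult_keysE: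
  fixes p q :: "('v, 'k::field) mpoly"
  assumes "m \<in> Poly_Mapping.keys (p * q)"
  obtains a b where "a \<in> Poly_Mapping.keys p" "b \<in> Poly_Mapping.keys q" "m = a + b"
    "Poly_Mapping.keys m = Poly_Mapping.keys a \<union> Poly_Mapping.keys b"
proof -
  obtain a b where "a \<in> Poly_Mapping.keys p" "b \<in> Poly_Mapping.keys q" "m = a + b"
    using assms keys_mult[of p q] by blast
  then show ?thesis using that[of a b] by (simp add: keys_add_nat)
qed

text \<open>
  The polynomials in the variables \<open>V\<close>, that is, the carrier of \<open>mpoly_ring V\<close>.
\<close>
definition polys :: "'v set \<Rightarrow> ('v, 'k::field) mpoly set" where
  "polys V = {p. \<forall>m\<in>Poly_Mapping.keys p. Poly_Mapping.keys m \<subseteq> V}"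

lemma mpoly_ring_simps [simp]:
  "carrier (mpoly_ring V) = polys V" "x \<otimes>\<^bsub>mpoly_ring V\<^esub> y = x * y" "\<one>\<^bsub>mpoly_ring V\<^esub> = 1"
  "x \<oplus>\<^bsub>mpoly_ring V\<^esub> y = x + y" "\<zero>\<^bsub>mpoly_ring V\<^esub> = 0"
  by (simp_all add: mpoly_ring_def polys_def)

lemma keys_diff_subset:
  fixes p q :: "'a \<Rightarrow>\<^sub>0 'b::ab_group_add"
  shows "Poly_Mapping.keys (p - q) \<subseteq> Poly_Mapping.keys p \<union> Poly_Mapping.keys q"
  by (auto simp: in_keys_iff lookup_minus)

lemma subring_polys: "subring_set (polys V :: ('v, 'k::field) mpoly set)"
proof -
  have "p * q \<in> polys V" if "p \<in> polys V" "q \<in> polys V" for p q :: "('v, 'k) mpoly"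
    unfolding polys_def
  proof (intro CollectI ballI)
    fix m assume "m \<in> Poly_Mapping.keys (p * q)"
    then show "Poly_Mapping.keys m \<subseteq> V"
      by (rule mpoly_mult_keysE) (use that in \<open>auto simp: polys_def\<close>)
  qed
  moreover have "p + q \<in> polys V" "p - q \<in> polys V" if "p \<in> polys V" "q \<in> polys V" for p q :: "('v, 'k) mpoly"
    using that keys_add[of p q] keys_diff_subset[of p q] unfolding polys_def by blast+
  moreover have "1 \<in> (polys V :: ('v, 'k) mpoly set)" by (simp add: polys_def)
  ultimately show ?thesis by (simp add: subring_set_def)
qed

lemmas polys_closed = subring_setD[OF subring_polys]

lemma const_polys [simp]: "Poly_Mapping.single 0 c \<in> polys V"
  by (simp add: polys_def)

lemma cring_mpoly_ring: "cring (mpoly_ring V :: ('v, 'k::field) mpoly ring)"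
proof (rule cringI)
  let ?R = "mpoly_ring V :: ('v, 'k::field) mpoly ring"
  show "abelian_group ?R"
  proof (rule abelian_groupI)
    show "\<exists>y\<in>carrier ?R. y \<oplus>\<^bsub>?R\<^esub> x = \<zero>\<^bsub>?R\<^esub>" if "x \<in> carrier ?R" for x
      by (rule bexI[of _ "- x"]) (use that in \<open>simp_all add: polys_closed\<close>)
  qed (simp_all add: polys_closed add_ac)
  show "Group.comm_monoid ?R"
    by (rule Group.comm_monoidI) (simp_all add: polys_closed mult_ac)
  show "(x \<oplus>\<^bsub>?R\<^esub> y) \<otimes>\<^bsub>?R\<^esub> z = x \<otimes>\<^bsub>?R\<^esub> z \<oplus>\<^bsub>?R\<^esub> y \<otimes>\<^bsub>?R\<^esub> z" for x y z
    by (simp add: distrib_right)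
qed

lemma ideal_mpoly_ring:
  assumes "ideal_of (polys V) J"
  shows "ideal J (mpoly_ring V :: ('v, 'k::field) mpoly ring)"
proof (rule idealI)
  let ?R = "mpoly_ring V :: ('v, 'k) mpoly ring"
  interpret cring ?R by (rule cring_mpoly_ring)
  note Jc = ideal_ofD[OF subring_polys assms]
  show "ring ?R" by (rule ring_axioms)
  show "subgroup J (add_monoid ?R)"
  proof (rule add.subgroupI)
    show "J \<subseteq> carrier ?R" using Jc(1) by simp
    show "J \<noteq> {}" using Jc(2) by blast
    fix a assume a: "a \<in> J"
    have "\<ominus>\<^bsub>?R\<^esub> a = - a"
      by (rule minus_equality) (use a Jc(1) in \<open>auto simp: polys_closed\<close>)
    then show "\<ominus>\<^bsub>?R\<^esub> a \<in> J" using Jc(6)[OF Jc(2) a] by simp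
  next
    show "a \<oplus>\<^bsub>?R\<^esub> b \<in> J" if "a \<in> J" "b \<in> J" for a b
      using Jc(3) that by simp
  qed
  show "x \<otimes>\<^bsub>?R\<^esub> a \<in> J" "a \<otimes>\<^bsub>?R\<^esub> x \<in> J" if "a \<in> J" "x \<in> carrier ?R" for a x
    using Jc(4,5) that by simp_all
qed

text \<open>
  Polynomials in which the support (the set of variables) of every monomial satisfies \<open>F\<close>. For
  upward closed \<open>F\<close> this is the squarefree monomial ideal of the supports in \<open>F\<close>. Both edge ideals and
  the ideals generated by sets of variables are of this form.
\<close>
definition supp_ideal :: "'v set \<Rightarrow> ('v set \<Rightarrow> bool) \<Rightarrow> ('v, 'k::field) mpoly set" where
  "supp_ideal V F = {p \<in> polys V. \<forall>m\<in>Poly_Mapping.keys p. F (Poly_Mapping.keys m)}"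

lemma supp_ideal_ideal:
  assumes "\<And>A B. F A \<Longrightarrow> A \<subseteq> B \<Longrightarrow> F B"
  shows "ideal_of (polys V) (supp_ideal V F :: ('v, 'k::field) mpoly set)"
proof -
  have "p + q \<in> supp_ideal V F" if "p \<in> supp_ideal V F" "q \<in> supp_ideal V F" for p q :: "('v, 'k) mpoly"
    using that keys_add[of p q] unfolding supp_ideal_def by (auto simp: polys_closed)
  moreover have "c * p \<in> supp_ideal V F" if "c \<in> polys V" "p \<in> supp_ideal V F" for c p :: "('v, 'k) mpoly"
  proof -
    have "F (Poly_Mapping.keys m)" if m: "m \<in> Poly_Mapping.keys (c * p)" for m
      using m
    proof (rule mpoly_mult_keysE)
      fix a b assume "b \<in> Poly_Mapping.keys p" "Poly_Mapping.keys m = Poly_Mapping.keys a \<union> Poly_Mapping.keys b"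
      then show ?thesis using \<open>p \<in> supp_ideal V F\<close> assms by (auto simp: supp_ideal_def)
    qed
    then show ?thesis using that by (auto simp: supp_ideal_def polys_closed)
  qed
  moreover have "0 \<in> (supp_ideal V F :: ('v, 'k) mpoly set)"
    by (simp add: supp_ideal_def polys_closed)
  moreover have "supp_ideal V F \<subseteq> (polys V :: ('v, 'k) mpoly set)" by (auto simp: supp_ideal_def)
  ultimately show ?thesis unfolding ideal_of_def by (intro conjI ballI)
qed

text \<open>
  The supports of the monomials that lie in the edge ideal.
\<close>
definition contains_edge :: "'v sgraph \<Rightarrow> 'v set \<Rightarrow> bool" where
  "contains_edge G A \<longleftrightarrow> (\<exists>e\<in>edges G. e \<subseteq> A)"

lemma edge_ideal_eq:
  assumes "simple_graph G"
  shows "(edge_ideal G :: ('v, 'k::field) mpoly set) = supp_ideal (verts G) (contains_edge G)"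
proof
  let ?R = "mpoly_ring (verts G) :: ('v, 'k) mpoly ring"
  let ?I = "supp_ideal (verts G) (contains_edge G) :: ('v, 'k) mpoly set"
  let ?gens = "{mpoly_var u * mpoly_var v | u v. {u, v} \<in> edges G} :: ('v, 'k) mpoly set"
  interpret finite_graph G by unfold_locales (rule assms)
  interpret cring ?R by (rule cring_mpoly_ring)
  have I: "ideal_of (polys (verts G)) ?I"
    by (rule supp_ideal_ideal) (auto simp: contains_edge_def)
  have var_mult: "mpoly_var u * mpoly_var v
      = (Poly_Mapping.single (Poly_Mapping.single u 1 + Poly_Mapping.single v 1) 1 :: ('v, 'k) mpoly)" for u v
    by (simp add: mpoly_var_def mult_single)
  have gens: "?gens \<subseteq> ?I"
  proof
    fix p assume "p \<in> ?gens"
    then obtain u v where uv: "p = mpoly_var u * mpoly_var v" "{u, v} \<in> edges G" by blast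
    have "Poly_Mapping.keys (Poly_Mapping.single u 1 + Poly_Mapping.single v (1::nat)) = {u, v}"
      by (auto simp: keys_add_nat)
    then show "p \<in> ?I"
      using adj_verts[OF uv(2)] uv unfolding uv(1) var_mult
      by (auto simp: supp_ideal_def polys_def contains_edge_def)
  qed
  show "edge_ideal G \<subseteq> ?I"
    unfolding edge_ideal_def by (rule genideal_minimal[OF ideal_mpoly_ring[OF I] gens])
  have gensC: "?gens \<subseteq> carrier ?R" using gens by (auto simp: supp_ideal_def)
  interpret E: ideal "edge_ideal G" ?R
    unfolding edge_ideal_def by (rule genideal_ideal[OF gensC])
  show "?I \<subseteq> edge_ideal G"
  proof
    fix p :: "('v, 'k) mpoly" assume p: "p \<in> ?I"
    have "Poly_Mapping.single m c \<in> edge_ideal G" if m: "m \<in> Poly_Mapping.keys p" for m and c :: 'k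
    proof -
      obtain e where e: "e \<in> edges G" "e \<subseteq> Poly_Mapping.keys m"
        using p m by (auto simp: supp_ideal_def contains_edge_def)
      obtain u v where uv: "e = {u, v}" "u \<noteq> v" using edge_cases[OF e(1)] .
      let ?uv = "Poly_Mapping.single u 1 + Poly_Mapping.single v (1::nat)"
      let ?n = "m - ?uv"
      have "Poly_Mapping.lookup ?uv x \<le> Poly_Mapping.lookup m x" for x
        using e(2) uv by (auto simp: lookup_add lookup_single when_def in_keys_iff Suc_le_eq)
      then have "m = ?n + ?uv"
        by (intro poly_mapping_eqI) (simp add: lookup_add lookup_minus)
      then have eq: "Poly_Mapping.single m c = Poly_Mapping.single ?n c * (mpoly_var u * mpoly_var v)"
        unfolding var_mult mult_single by simp
      have "Poly_Mapping.keys ?n \<subseteq> Poly_Mapping.keys m"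
        by (auto simp: in_keys_iff lookup_minus)
      then have "Poly_Mapping.single ?n c \<in> carrier ?R"
        using p m by (auto simp: supp_ideal_def polys_def)
      moreover have "(mpoly_var u * mpoly_var v :: ('v, 'k) mpoly) \<in> edge_ideal G"
        unfolding edge_ideal_def
        by (rule subsetD[OF genideal_self[OF gensC]]) (use e(1) uv(1) in blast)
      ultimately show ?thesis
        using E.I_l_closed[of "mpoly_var u * mpoly_var v" "Poly_Mapping.single ?n c"]
        unfolding eq by simp
    qed
    moreover have sum_closed: "sum g X \<in> edge_ideal G" if "finite X" "\<And>x. x \<in> X \<Longrightarrow> g x \<in> edge_ideal G"
      for g :: "_ \<Rightarrow> ('v, 'k) mpoly" and X
      using that
    proof (induction X rule: finite_induct)
      case empty
      then show ?case using E.zero_closed by simp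
    next
      case (insert x F)
      then show ?case using E.a_closed[of "g x" "sum g F"] by simp
    qed
    ultimately show "p \<in> edge_ideal G"
      by (subst poly_mapping_sum_singles, intro sum_closed) auto
  qed
qed

text \<open>
  Among the monomials of \<open>p\<close> with property \<open>P\<close> there is one of largest weight.
\<close>
lemma exists_leading_monomial:
  fixes p :: "('v, 'k::field) mpoly" and w :: "('v \<Rightarrow>\<^sub>0 nat) \<Rightarrow> 'o::linorder"
  assumes "m \<in> Poly_Mapping.keys p" "P m"
  obtains a where "a \<in> Poly_Mapping.keys p" "P a" "\<And>n. n \<in> Poly_Mapping.keys p \<Longrightarrow> P n \<Longrightarrow> w n \<le> w a"
proof -
  let ?K = "{n \<in> Poly_Mapping.keys p. P n}"
  have "finite ?K" "?K \<noteq> {}" using assms by auto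
  then have "Max (w ` ?K) \<in> w ` ?K" and max: "w n \<le> Max (w ` ?K)" if "n \<in> ?K" for n
    using that by auto
  then obtain a where a: "a \<in> ?K" "Max (w ` ?K) = w a" using assms by blast
  then show ?thesis using that[of a] max by auto
qed

text \<open>
  The ideal generated by the variables outside a finite set \<open>X\<close> is prime. Monomials supported in \<open>X\<close>
  are compared by an additive weight in \<open>int poly\<close>, a linearly ordered group, that is injective on
  them; the product of the two leading monomials then survives in the product.
\<close>
lemma supp_ideal_prime:
  fixes p q :: "('v, 'k::field) mpoly"
  assumes X: "finite X" and pq: "p \<in> polys V" "q \<in> polys V"
    and "p * q \<in> supp_ideal V (\<lambda>A. \<not> A \<subseteq> X)"
  shows "p \<in> supp_ideal V (\<lambda>A. \<not> A \<subseteq> X) \<or> q \<in> supp_ideal V (\<lambda>A. \<not> A \<subseteq> X)"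
proof (rule ccontr)
  assume neg: "\<not> ?thesis"
  let ?in = "\<lambda>m. Poly_Mapping.keys m \<subseteq> X"
  obtain e :: "'v \<Rightarrow> nat" where e: "inj_on e X"
    using finite_imp_inj_to_nat_seg[OF X] by blast
  define w :: "('v \<Rightarrow>\<^sub>0 nat) \<Rightarrow> int poly"
    where "w m = (\<Sum>v\<in>X. Polynomial.monom (int (Poly_Mapping.lookup m v)) (e v))" for m
  have w_add: "w (m + n) = w m + w n" for m n
    by (simp add: w_def lookup_add add_monom[symmetric] sum.distrib)
  have w_inj: "m = n" if "w m = w n" "?in m" "?in n" for m n
  proof (rule poly_mapping_eqI)
    fix v
    have coeff: "Polynomial.coeff (w a) (e v) = int (Poly_Mapping.lookup a v)" if "v \<in> X" for a
    proof -
      have "Polynomial.coeff (w a) (e v) = (\<Sum>u\<in>X. if u = v then int (Poly_Mapping.lookup a v) else 0)"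
        unfolding w_def coeff_sum by (intro sum.cong) (use e that in \<open>auto simp: inj_on_def\<close>)
      then show ?thesis using X that by simp
    qed
    show "Poly_Mapping.lookup m v = Poly_Mapping.lookup n v"
    proof (cases "v \<in> X")
      case True
      then show ?thesis using coeff[OF True, of m] coeff[OF True, of n] that(1) by simp
    next
      case False
      then have "v \<notin> Poly_Mapping.keys m" "v \<notin> Poly_Mapping.keys n" using that by auto
      then show ?thesis by (simp add: in_keys_iff)
    qed
  qed
  obtain a where a: "a \<in> Poly_Mapping.keys p" "?in a"
      "\<And>n. n \<in> Poly_Mapping.keys p \<Longrightarrow> ?in n \<Longrightarrow> w n \<le> w a"
    using neg pq exists_leading_monomial[of _ p ?in w] by (auto simp: supp_ideal_def)
  obtain b where b: "b \<in> Poly_Mapping.keys q" "?in b"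
      "\<And>n. n \<in> Poly_Mapping.keys q \<Longrightarrow> ?in n \<Longrightarrow> w n \<le> w b"
    using neg pq exists_leading_monomial[of _ q ?in w] by (auto simp: supp_ideal_def)
  have "Poly_Mapping.lookup (p * q) (a + b) = Poly_Mapping.lookup p a * Poly_Mapping.lookup q b"
  proof (rule lookup_mult_unique)
    fix m n assume mn: "m \<in> Poly_Mapping.keys p" "n \<in> Poly_Mapping.keys q" "m + n = a + b"
    have "Poly_Mapping.keys (m + n) \<subseteq> X" using mn(3) a(2) b(2) by (simp add: keys_add_nat)
    then have in': "?in m" "?in n" by (auto simp: keys_add_nat)
    have "w m + w n = w a + w b" using mn(3) w_add by metis
    moreover have "w m \<le> w a" "w n \<le> w b" using a(3) b(3) mn in' by auto
    ultimately have "w m = w a" "w n = w b" by auto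
    then show "m = a \<and> n = b" using w_inj in' a(2) b(2) by blast
  qed
  then have "a + b \<in> Poly_Mapping.keys (p * q)"
    using a(1) b(1) by (simp add: in_keys_iff)
  moreover have "?in (a + b)" using a(2) b(2) by (simp add: keys_add_nat)
  ultimately show False using assms(4) by (auto simp: supp_ideal_def)
qed

text \<open>
  All exponents of all variables in \<open>p\<close> are at most \<open>D\<close>.
\<close>
definition exp_bound :: "nat \<Rightarrow> ('v, 'k::field) mpoly \<Rightarrow> bool" where
  "exp_bound D p \<longleftrightarrow> (\<forall>m\<in>Poly_Mapping.keys p. \<forall>v. Poly_Mapping.lookup m v \<le> D)"

lemma exp_bound_mono: "exp_bound D p \<Longrightarrow> D \<le> E \<Longrightarrow> exp_bound E p"
  unfolding exp_bound_def
proof (intro ballI allI)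
  fix m v assume "\<forall>m\<in>Poly_Mapping.keys p. \<forall>v. Poly_Mapping.lookup m v \<le> D" "D \<le> E" "m \<in> Poly_Mapping.keys p"
  then have "Poly_Mapping.lookup m v \<le> D" by blast
  then show "Poly_Mapping.lookup m v \<le> E" using \<open>D \<le> E\<close> by simp
qed

lemma exp_bound_mult: "exp_bound D p \<Longrightarrow> exp_bound E q \<Longrightarrow> exp_bound (D + E) (p * q)"
  unfolding exp_bound_def
proof (intro ballI allI)
  fix m v assume *: "\<forall>m\<in>Poly_Mapping.keys p. \<forall>v. Poly_Mapping.lookup m v \<le> D"
    "\<forall>m\<in>Poly_Mapping.keys q. \<forall>v. Poly_Mapping.lookup m v \<le> E" "m \<in> Poly_Mapping.keys (p * q)"
  obtain a b where "a \<in> Poly_Mapping.keys p" "b \<in> Poly_Mapping.keys q" "m = a + b"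
    using *(3) by (rule mpoly_mult_keysE)
  then show "Poly_Mapping.lookup m v \<le> D + E"
    using *(1,2) by (simp add: lookup_add add_mono)
qed

lemma exp_bound_one: "exp_bound D 1"
  by (simp add: exp_bound_def)

lemma exp_bound_power: "exp_bound D p \<Longrightarrow> exp_bound (n * D) (p ^ n)"
proof (induction n)
  case (Suc n)
  then show ?case using exp_bound_mult[of D p "n * D" "p ^ n"] by simp
qed (simp add: exp_bound_one)

lemma exp_bound_exists: "\<exists>D. exp_bound D p"
proof -
  let ?L = "\<Union>m\<in>Poly_Mapping.keys p. insert 0 (Poly_Mapping.lookup m ` Poly_Mapping.keys m)"
  have "Poly_Mapping.lookup m v \<le> Max ?L" if "m \<in> Poly_Mapping.keys p" for m v
  proof (rule Max_ge)
    have "Poly_Mapping.lookup m v \<in> insert 0 (Poly_Mapping.lookup m ` Poly_Mapping.keys m)"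
      by (metis image_eqI insertCI not_in_keys_iff_lookup_eq_zero)
    then show "Poly_Mapping.lookup m v \<in> ?L" using that by blast
  qed simp
  then show ?thesis by (auto simp: exp_bound_def)
qed

lemma exp_bound_exists_list: "\<exists>D. \<forall>f\<in>set fs. exp_bound D f"
proof (induction fs)
  case (Cons f fs)
  then obtain D where "\<forall>f\<in>set fs. exp_bound D f" by blast
  moreover obtain E where "exp_bound E f" using exp_bound_exists[of f] by blast
  ultimately have "\<forall>g\<in>set (f # fs). exp_bound (max D E) g"
    by (metis exp_bound_mono max.cobounded1 max.cobounded2 set_ConsD)
  then show ?case by blast
qed simp

lemma exp_bound_mpow:
  assumes "\<forall>f\<in>set fs. exp_bound D f" "set as \<subseteq> {..<N}"
  shows "exp_bound (length fs * (N * D)) (mpow fs as)"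
  using assms
proof (induction fs as rule: mpow.induct)
  case (1 f fs a as)
  have "a * D \<le> N * D" using "1.prems"(2) by simp
  moreover have "exp_bound (a * D) (f ^ a)" using "1.prems"(1) by (simp add: exp_bound_power)
  ultimately have "exp_bound (N * D) (f ^ a)" by (rule exp_bound_mono[rotated])
  then have "exp_bound (N * D + length fs * (N * D)) (f ^ a * mpow fs as)"
    using "1.IH" "1.prems" by (intro exp_bound_mult) auto
  then show ?case by simp
qed (auto simp: exp_bound_one)

lemma card_bounded_monomials:
  assumes "finite T"
  shows "finite {m. Poly_Mapping.keys m \<subseteq> T \<and> (\<forall>v. Poly_Mapping.lookup m v \<le> B)}" (is "finite ?E")
    and "card {m. Poly_Mapping.keys m \<subseteq> T \<and> (\<forall>v. Poly_Mapping.lookup m v \<le> B)} \<le> (B + 1) ^ card T"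
proof -
  let ?r = "\<lambda>m. restrict (Poly_Mapping.lookup m) T"
  have inj: "inj_on ?r ?E"
  proof (rule inj_onI)
    fix m n assume mn: "m \<in> ?E" "n \<in> ?E" "?r m = ?r n"
    show "m = n"
    proof (rule poly_mapping_eqI)
      fix v
      show "Poly_Mapping.lookup m v = Poly_Mapping.lookup n v"
      proof (cases "v \<in> T")
        case True
        then show ?thesis using mn(3) by (metis restrict_apply')
      next
        case False
        then have "v \<notin> Poly_Mapping.keys m" "v \<notin> Poly_Mapping.keys n" using mn by auto
        then show ?thesis by (simp add: in_keys_iff)
      qed
    qed
  qed
  have img: "?r ` ?E \<subseteq> (T \<rightarrow>\<^sub>E {..B})" by auto
  have fin: "finite (T \<rightarrow>\<^sub>E {..B})" using assms by (simp add: finite_PiE)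
  show "finite ?E" using inj img fin inj_on_finite by blast
  have "card ?E \<le> card (T \<rightarrow>\<^sub>E {..B})" using inj img fin by (rule card_inj_on_le)
  then show "card ?E \<le> (B + 1) ^ card T" using assms by (simp add: card_PiE)
qed

section \<open>Depth of the edge ring\<close>

text \<open>
  The depth is at most the size of any maximal independent set \<open>T\<close>. Let \<open>y\<close> be the product of the
  variables in \<open>T\<close>. Its annihilator modulo the edge ideal is generated by the variables outside \<open>T\<close>,
  as each of these has a neighbour in \<open>T\<close>. Hence a linear combination of products of members of \<open>fs\<close>
  kills \<open>y\<close> as soon as its part in the variables \<open>T\<close> vanishes. If the length \<open>d\<close> of \<open>fs\<close> exceeds
  \<open>card T\<close>, such a nontrivial combination exists: there are \<open>N ^ d\<close> products with exponents below
  \<open>N\<close>, but their parts in the variables \<open>T\<close> lie in a space of dimension \<open>O (N ^ card T)\<close>. This contradicts \<open>regular_chain_independent\<close>.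
\<close>
lemma depth_le_maximal_independent:
  fixes G :: "'v sgraph" and J :: "nat \<Rightarrow> ('v, 'k::field) mpoly set"
  assumes G: "simple_graph G" and T: "finite_graph.maximal_independent G T"
    and chain: "regular_chain (polys (verts G)) J fs"
    and J0: "J 0 = {p \<in> polys (verts G). \<exists>u. u \<in> polys (verts G) \<and> Poly_Mapping.lookup u 0 \<noteq> 0 \<and> u * p \<in> edge_ideal G}"
  shows "length fs \<le> card T"
proof (rule ccontr)
  assume neg: "\<not> ?thesis"
  interpret finite_graph G by unfold_locales (rule G)
  let ?C = "polys (verts G) :: ('v, 'k) mpoly set"
  have indT: "independent T" and TV: "T \<subseteq> verts G"
    using T by (auto simp: maximal_independent_def independent_def)
  have finT: "finite T" using indT by (rule independent_finite)
  define b :: "'v \<Rightarrow>\<^sub>0 nat" where "b = (\<Sum>t\<in>T. Poly_Mapping.single t 1)"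
  have lb: "Poly_Mapping.lookup b v = (if v \<in> T then 1 else 0)" for v
    unfolding b_def lookup_sum using finT by (simp add: lookup_single when_def)
  have kb: "Poly_Mapping.keys b = T" by (auto simp: in_keys_iff lb split: if_splits)
  define y :: "('v, 'k) mpoly" where "y = Poly_Mapping.single b 1"
  have ky: "Poly_Mapping.keys y = {b}" by (simp add: y_def)
  have yC: "y \<in> ?C" using TV by (simp add: polys_def ky kb)
  have noedge: "\<not> contains_edge G T"
  proof
    assume "contains_edge G T"
    then obtain e where e: "e \<in> edges G" "e \<subseteq> T" by (auto simp: contains_edge_def)
    obtain u v where "e = {u, v}" using edge_cases[OF e(1)] by blast
    then show False using e indT by (auto simp: independent_def)
  qed
  have yJ: "y \<notin> J 0"
  proof
    assume "y \<in> J 0"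
    then obtain u where u: "Poly_Mapping.lookup u 0 \<noteq> 0" "u * y \<in> edge_ideal G" using J0 by blast
    have "Poly_Mapping.lookup (u * y) (0 + b) = Poly_Mapping.lookup u 0 * Poly_Mapping.lookup y b"
      by (rule lookup_mult_unique) (auto simp: ky)
    then have "b \<in> Poly_Mapping.keys (u * y)" using u(1) by (simp add: in_keys_iff y_def)
    then have "contains_edge G (Poly_Mapping.keys b)"
      using u(2) unfolding edge_ideal_eq[OF G] supp_ideal_def by blast
    then show False using noedge by (simp add: kb)
  qed
  let ?d = "length fs"
  obtain D where D: "\<forall>f\<in>set fs. exp_bound D f" using exp_bound_exists_list by blast
  \<comment> \<open>\<open>N\<close> is chosen so that the number of monomials in \<open>E\<close> is below \<open>N ^ ?d\<close>\<close>
  define N where "N = (?d * D + 1) ^ card T + 1"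
  define B where "B = ?d * (N * D)"
  define E where "E = {m. Poly_Mapping.keys m \<subseteq> T \<and> (\<forall>v. Poly_Mapping.lookup m v \<le> B)}"
  have finE: "finite E" unfolding E_def by (rule card_bounded_monomials(1)[OF finT])
  have "card E \<le> (B + 1) ^ card T" unfolding E_def by (rule card_bounded_monomials(2)[OF finT])
  also have "\<dots> \<le> ((?d * D + 1) * N) ^ card T"
    by (rule power_mono) (auto simp: B_def N_def algebra_simps)
  also have "\<dots> = (?d * D + 1) ^ card T * N ^ card T" by (rule power_mult_distrib)
  also have "\<dots> < N * N ^ card T" by (simp add: N_def)
  also have "\<dots> = N ^ Suc (card T)" by simp
  also have "\<dots> \<le> N ^ ?d" using neg by (intro power_increasing) (auto simp: N_def)
  finally have "card E < card (exps ?d N)" by (simp add: card_exps)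
  then obtain c :: "nat list \<Rightarrow> 'k" where c: "\<exists>as\<in>exps ?d N. c as \<noteq> 0"
      "\<forall>m\<in>E. (\<Sum>as\<in>exps ?d N. c as * Poly_Mapping.lookup (mpow fs as) m) = 0"
    using linear_dependence[OF finE finite_exps, of ?d N "\<lambda>as. Poly_Mapping.lookup (mpow fs as)"] by blast
  define g where "g = (\<Sum>as\<in>exps ?d N. Poly_Mapping.single 0 (c as) * mpow fs as)"
  have lg: "Poly_Mapping.lookup g m = (\<Sum>as\<in>exps ?d N. c as * Poly_Mapping.lookup (mpow fs as) m)" for m
    by (simp add: g_def lookup_sum lookup_const_mult)
  \<comment> \<open>monomials supported in \<open>T\<close> but outside \<open>E\<close> occur in no product\<close>
  have outside: "\<not> Poly_Mapping.keys m \<subseteq> T" if m: "m \<in> Poly_Mapping.keys g" for m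
  proof
    assume mT: "Poly_Mapping.keys m \<subseteq> T"
    have "m \<notin> E" using m c(2) by (auto simp: in_keys_iff lg)
    then obtain v where v: "\<not> Poly_Mapping.lookup m v \<le> B" using mT by (auto simp: E_def)
    have "Poly_Mapping.lookup (mpow fs as) m = 0" if "as \<in> exps ?d N" for as
    proof -
      have "exp_bound B (mpow fs as)"
        using exp_bound_mpow[OF D, of as N] that by (simp add: B_def exps_def)
      then show ?thesis using v by (auto simp: exp_bound_def in_keys_iff)
    qed
    then show False using m by (simp add: in_keys_iff lg)
  qed
  have gC: "g \<in> ?C"
  proof -
    have "set fs \<subseteq> ?C" using chain by (simp add: regular_chain_def)
    then show ?thesis
      unfolding g_def using mpow_closed[OF subring_polys]
      by (intro subring_set_sum[OF subring_polys] polys_closed(5) const_polys) auto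
  qed
  have edge: "contains_edge G (Poly_Mapping.keys m \<union> T)" if m: "m \<in> Poly_Mapping.keys g" for m
  proof -
    obtain v where v: "v \<in> Poly_Mapping.keys m" "v \<notin> T"
      using outside[OF m] by blast
    have "v \<in> verts G" using gC m v(1) by (auto simp: polys_def)
    then obtain t where "t \<in> T" "{v, t} \<in> edges G"
      using T v(2) by (auto simp: maximal_independent_def)
    then show ?thesis
      unfolding contains_edge_def by (intro bexI[of _ "{v, t}"]) (use v(1) in auto)
  qed
  have gyC: "g * y \<in> ?C" using gC yC by (rule polys_closed(5))
  have "contains_edge G (Poly_Mapping.keys m)" if m: "m \<in> Poly_Mapping.keys (g * y)" for m
    using m by (rule mpoly_mult_keysE) (use edge in \<open>auto simp: ky kb\<close>)
  then have "g * y \<in> edge_ideal G"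
    unfolding edge_ideal_eq[OF G] supp_ideal_def using gyC by blast
  then have "g * y \<in> J 0"
    unfolding J0 using gyC by (intro CollectI conjI exI[of _ 1]) (simp_all add: polys_closed)
  moreover have "g * y \<notin> J 0"
    unfolding g_def
    by (rule regular_chain_independent[OF subring_polys _ _ _ _ chain yC yJ c(1)]) (auto simp: mult_single)
  ultimately show False by simp
qed

section \<open>Localization at a prime ideal\<close>

context primeideal
begin

abbreviation denoms :: "'a set" where "denoms \<equiv> carrier R - I"

text \<open>
  The class of \<open>r / s\<close> in the localization at the prime ideal \<open>I\<close>.
\<close>
definition fraction :: "'a \<Rightarrow> 'a \<Rightarrow> ('a \<times> 'a) set" where
  "fraction r s = frac_rel R denoms `` {(r, s)}"

lemma denoms_mult: "s \<in> denoms \<Longrightarrow> t \<in> denoms \<Longrightarrow> s \<otimes> t \<in> denoms"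
  using I_prime by blast

lemma denoms_one: "\<one> \<in> denoms"
  using one_imp_carrier I_notcarr by blast

lemma frac_rel_iff:
  "((r, s), (r', s')) \<in> frac_rel R denoms \<longleftrightarrow> r \<in> carrier R \<and> s \<in> denoms \<and> r' \<in> carrier R \<and> s' \<in> denoms \<and>
    (\<exists>t\<in>denoms. t \<otimes> (r \<otimes> s' \<ominus> r' \<otimes> s) = \<zero>)"
  by (auto simp: frac_rel_def)

lemma equiv_frac_rel: "equiv (carrier R \<times> denoms) (frac_rel R denoms)"
proof (rule equivI)
  show "frac_rel R denoms \<subseteq> (carrier R \<times> denoms) \<times> (carrier R \<times> denoms)"
    by (auto simp: frac_rel_def)
  show "refl_on (carrier R \<times> denoms) (frac_rel R denoms)"
  proof (rule refl_onI)
    fix x assume "x \<in> carrier R \<times> denoms"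
    then obtain r s where x: "x = (r, s)" "r \<in> carrier R" "s \<in> denoms" by blast
    have "\<one> \<otimes> (r \<otimes> s \<ominus> r \<otimes> s) = \<zero>" using x(2,3) by (simp add: a_minus_def r_neg)
    then show "(x, x) \<in> frac_rel R denoms" unfolding x(1) frac_rel_iff using x denoms_one by blast
  qed
  show "sym (frac_rel R denoms)"
  proof (rule symI)
    fix x y assume xy: "(x, y) \<in> frac_rel R denoms"
    obtain r s r' s' where eq: "x = (r, s)" "y = (r', s')" by (cases x, cases y)
    obtain t where t: "t \<in> denoms" "t \<otimes> (r \<otimes> s' \<ominus> r' \<otimes> s) = \<zero>"
      and c: "r \<in> carrier R" "s \<in> denoms" "r' \<in> carrier R" "s' \<in> denoms"
      using xy unfolding eq frac_rel_iff by blast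
    have "t \<in> carrier R" "s \<in> carrier R" "s' \<in> carrier R" using t c by auto
    then have "t \<otimes> (r' \<otimes> s \<ominus> r \<otimes> s') = \<ominus> (t \<otimes> (r \<otimes> s' \<ominus> r' \<otimes> s))"
      using c(1,3) by algebra
    then have "t \<otimes> (r' \<otimes> s \<ominus> r \<otimes> s') = \<zero>" using t by simp
    then show "(y, x) \<in> frac_rel R denoms" unfolding eq frac_rel_iff using t c by blast
  qed
  show "trans (frac_rel R denoms)"
  proof (rule transI)
    fix x y z assume xy: "(x, y) \<in> frac_rel R denoms" and yz: "(y, z) \<in> frac_rel R denoms"
    obtain r s r' s' r'' s'' where eq: "x = (r, s)" "y = (r', s')" "z = (r'', s'')"
      by (cases x, cases y, cases z)
    obtain t where t: "t \<in> denoms" "t \<otimes> (r \<otimes> s' \<ominus> r' \<otimes> s) = \<zero>"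
      and c: "r \<in> carrier R" "s \<in> denoms" "r' \<in> carrier R" "s' \<in> denoms"
      using xy unfolding eq frac_rel_iff by blast
    obtain u where u: "u \<in> denoms" "u \<otimes> (r' \<otimes> s'' \<ominus> r'' \<otimes> s') = \<zero>"
      and c': "r'' \<in> carrier R" "s'' \<in> denoms"
      using yz unfolding eq frac_rel_iff by blast
    have cc: "t \<in> carrier R" "u \<in> carrier R" "s \<in> carrier R" "s' \<in> carrier R" "s'' \<in> carrier R"
      using t u c c' by auto
    have "((t \<otimes> u) \<otimes> s') \<otimes> (r \<otimes> s'' \<ominus> r'' \<otimes> s)
        = (u \<otimes> s'') \<otimes> (t \<otimes> (r \<otimes> s' \<ominus> r' \<otimes> s)) \<oplus> (t \<otimes> s) \<otimes> (u \<otimes> (r' \<otimes> s'' \<ominus> r'' \<otimes> s'))"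
      using cc c(1,3) c'(1) by algebra
    then have "((t \<otimes> u) \<otimes> s') \<otimes> (r \<otimes> s'' \<ominus> r'' \<otimes> s) = \<zero>"
      unfolding t(2) u(2) using cc by simp
    moreover have "(t \<otimes> u) \<otimes> s' \<in> denoms" using t(1) u(1) c(4) denoms_mult by blast
    ultimately show "(x, z) \<in> frac_rel R denoms" unfolding eq frac_rel_iff using c c' by blast
  qed
qed

lemma fraction_eq_iff:
  assumes "r \<in> carrier R" "s \<in> denoms" "r' \<in> carrier R" "s' \<in> denoms"
  shows "fraction r s = fraction r' s' \<longleftrightarrow> (\<exists>t\<in>denoms. t \<otimes> (r \<otimes> s' \<ominus> r' \<otimes> s) = \<zero>)"
proof -
  have "fraction r s = fraction r' s' \<longleftrightarrow> ((r, s), (r', s')) \<in> frac_rel R denoms"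
    unfolding fraction_def by (rule eq_equiv_class_iff[OF equiv_frac_rel]) (use assms in auto)
  then show ?thesis unfolding frac_rel_iff using assms by blast
qed

lemma carrier_localization_at:
  "carrier (localization_at R I) = {fraction r s | r s. r \<in> carrier R \<and> s \<in> denoms}"
  by (auto simp: localization_at_def localization_def fraction_def quotient_def)

lemma one_localization_at: "\<one>\<^bsub>localization_at R I\<^esub> = fraction \<one> \<one>"
  and zero_localization_at: "\<zero>\<^bsub>localization_at R I\<^esub> = fraction \<zero> \<one>"
  by (simp_all add: localization_at_def localization_def fraction_def)

text \<open>
  An operation on pairs that respects equality of fractions is computed on representatives.
\<close>
lemma fraction_op:
  assumes op: "\<And>r s r' s' p q p' q'. ((r, s), (r', s')) \<in> frac_rel R denoms \<Longrightarrow>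
      ((p, q), (p', q')) \<in> frac_rel R denoms \<Longrightarrow> f r s p q = f r' s' p' q'"
    and "r \<in> carrier R" "s \<in> denoms" "p \<in> carrier R" "q \<in> denoms"
  shows "(\<Union>(r', s')\<in>fraction r s. \<Union>(p', q')\<in>fraction p q. f r' s' p' q') = f r s p q"
proof -
  let ?f = "\<lambda>x y. f (fst x) (snd x) (fst y) (snd y)"
  have "congruent2 (frac_rel R denoms) (frac_rel R denoms) ?f"
    unfolding congruent2_def using op by force
  then have "(\<Union>x\<in>fraction r s. \<Union>y\<in>fraction p q. ?f x y) = ?f (r, s) (p, q)"
    unfolding fraction_def by (intro UN_equiv_class2[OF equiv_frac_rel equiv_frac_rel]) (use assms in auto)
  then show ?thesis by (simp add: case_prod_beta')
qed

lemma fraction_mult: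
  assumes "r \<in> carrier R" "s \<in> denoms" "p \<in> carrier R" "q \<in> denoms"
  shows "fraction r s \<otimes>\<^bsub>localization_at R I\<^esub> fraction p q = fraction (r \<otimes> p) (s \<otimes> q)"
proof -
  have "(\<Union>(r, s)\<in>fraction r s. \<Union>(p, q)\<in>fraction p q. fraction (r \<otimes> p) (s \<otimes> q)) = fraction (r \<otimes> p) (s \<otimes> q)"
  proof (rule fraction_op[OF _ assms])
    fix r s r' s' p q p' q'
    assume *: "((r, s), (r', s')) \<in> frac_rel R denoms" "((p, q), (p', q')) \<in> frac_rel R denoms"
    obtain t where t: "t \<in> denoms" "t \<otimes> (r \<otimes> s' \<ominus> r' \<otimes> s) = \<zero>"
      and c: "r \<in> carrier R" "s \<in> denoms" "r' \<in> carrier R" "s' \<in> denoms"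
      using *(1) unfolding frac_rel_iff by blast
    obtain u where u: "u \<in> denoms" "u \<otimes> (p \<otimes> q' \<ominus> p' \<otimes> q) = \<zero>"
      and d: "p \<in> carrier R" "q \<in> denoms" "p' \<in> carrier R" "q' \<in> denoms"
      using *(2) unfolding frac_rel_iff by blast
    have cc: "t \<in> carrier R" "u \<in> carrier R" "s \<in> carrier R" "s' \<in> carrier R" "q \<in> carrier R" "q' \<in> carrier R"
      using t u c d by auto
    have "(t \<otimes> u) \<otimes> ((r \<otimes> p) \<otimes> (s' \<otimes> q') \<ominus> (r' \<otimes> p') \<otimes> (s \<otimes> q))
        = (u \<otimes> (p \<otimes> q')) \<otimes> (t \<otimes> (r \<otimes> s' \<ominus> r' \<otimes> s)) \<oplus> (t \<otimes> (r' \<otimes> s)) \<otimes> (u \<otimes> (p \<otimes> q' \<ominus> p' \<otimes> q))"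
      using cc c(1,3) d(1,3) by algebra
    then have "(t \<otimes> u) \<otimes> ((r \<otimes> p) \<otimes> (s' \<otimes> q') \<ominus> (r' \<otimes> p') \<otimes> (s \<otimes> q)) = \<zero>"
      unfolding t(2) u(2) using cc c d by simp
    moreover have "t \<otimes> u \<in> denoms" using t(1) u(1) denoms_mult by blast
    ultimately show "fraction (r \<otimes> p) (s \<otimes> q) = fraction (r' \<otimes> p') (s' \<otimes> q')"
      using fraction_eq_iff[of "r \<otimes> p" "s \<otimes> q" "r' \<otimes> p'" "s' \<otimes> q'"] c d denoms_mult by blast
  qed
  then show ?thesis
    by (simp add: localization_at_def localization_def fraction_def)
qed

lemma fraction_add:
  assumes "r \<in> carrier R" "s \<in> denoms" "p \<in> carrier R" "q \<in> denoms"
  shows "fraction r s \<oplus>\<^bsub>localization_at R I\<^esub> fraction p q = fraction (r \<otimes> q \<oplus> p \<otimes> s) (s \<otimes> q)"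
proof -
  have "(\<Union>(r, s)\<in>fraction r s. \<Union>(p, q)\<in>fraction p q. fraction (r \<otimes> q \<oplus> p \<otimes> s) (s \<otimes> q))
      = fraction (r \<otimes> q \<oplus> p \<otimes> s) (s \<otimes> q)"
  proof (rule fraction_op[OF _ assms])
    fix r s r' s' p q p' q'
    assume *: "((r, s), (r', s')) \<in> frac_rel R denoms" "((p, q), (p', q')) \<in> frac_rel R denoms"
    obtain t where t: "t \<in> denoms" "t \<otimes> (r \<otimes> s' \<ominus> r' \<otimes> s) = \<zero>"
      and c: "r \<in> carrier R" "s \<in> denoms" "r' \<in> carrier R" "s' \<in> denoms"
      using *(1) unfolding frac_rel_iff by blast
    obtain u where u: "u \<in> denoms" "u \<otimes> (p \<otimes> q' \<ominus> p' \<otimes> q) = \<zero>"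
      and d: "p \<in> carrier R" "q \<in> denoms" "p' \<in> carrier R" "q' \<in> denoms"
      using *(2) unfolding frac_rel_iff by blast
    have cc: "t \<in> carrier R" "u \<in> carrier R" "s \<in> carrier R" "s' \<in> carrier R" "q \<in> carrier R" "q' \<in> carrier R"
      using t u c d by auto
    have "(t \<otimes> u) \<otimes> ((r \<otimes> q \<oplus> p \<otimes> s) \<otimes> (s' \<otimes> q') \<ominus> (r' \<otimes> q' \<oplus> p' \<otimes> s') \<otimes> (s \<otimes> q))
        = (u \<otimes> (q \<otimes> q')) \<otimes> (t \<otimes> (r \<otimes> s' \<ominus> r' \<otimes> s)) \<oplus> (t \<otimes> (s \<otimes> s')) \<otimes> (u \<otimes> (p \<otimes> q' \<ominus> p' \<otimes> q))"
      using cc c(1,3) d(1,3) by algebra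
    then have "(t \<otimes> u) \<otimes> ((r \<otimes> q \<oplus> p \<otimes> s) \<otimes> (s' \<otimes> q') \<ominus> (r' \<otimes> q' \<oplus> p' \<otimes> s') \<otimes> (s \<otimes> q)) = \<zero>"
      unfolding t(2) u(2) using cc by simp
    moreover have "t \<otimes> u \<in> denoms" using t(1) u(1) denoms_mult by blast
    moreover have "r \<otimes> q \<oplus> p \<otimes> s \<in> carrier R" "r' \<otimes> q' \<oplus> p' \<otimes> s' \<in> carrier R" using cc c d by auto
    ultimately show "fraction (r \<otimes> q \<oplus> p \<otimes> s) (s \<otimes> q) = fraction (r' \<otimes> q' \<oplus> p' \<otimes> s') (s' \<otimes> q')"
      using fraction_eq_iff[of "r \<otimes> q \<oplus> p \<otimes> s" "s \<otimes> q" "r' \<otimes> q' \<oplus> p' \<otimes> s'" "s' \<otimes> q'"]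
        denoms_mult[OF c(2) d(2)] denoms_mult[OF c(4) d(4)] by blast
  qed
  then show ?thesis
    by (simp add: localization_at_def localization_def fraction_def)
qed

end

section \<open>Cohen--Macaulay graphs are well-covered\<close>

lemma a_inv_mpoly_ring:
  assumes "p \<in> polys V"
  shows "\<ominus>\<^bsub>mpoly_ring V\<^esub> p = - (p :: ('v, 'k::field) mpoly)"
proof -
  interpret cring "mpoly_ring V :: ('v, 'k) mpoly ring" by (rule cring_mpoly_ring)
  show ?thesis by (rule minus_equality) (use assms in \<open>auto simp: polys_closed\<close>)
qed

lemma a_minus_mpoly_ring:
  "p \<in> polys V \<Longrightarrow> q \<in> polys V \<Longrightarrow> p \<ominus>\<^bsub>mpoly_ring V\<^esub> q = p - (q :: ('v, 'k::field) mpoly)"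
  by (simp add: a_minus_def a_inv_mpoly_ring)

text \<open>
  The quotient of the polynomial ring by the edge ideal.
\<close>
definition edge_ring :: "'v sgraph \<Rightarrow> ('v, 'k::field) mpoly set ring" where
  "edge_ring G = mpoly_ring (verts G) Quot edge_ideal G"

text \<open>
  The residue class of a polynomial in the edge ring.
\<close>
definition edge_coset :: "'v sgraph \<Rightarrow> ('v, 'k::field) mpoly \<Rightarrow> ('v, 'k) mpoly set" where
  "edge_coset G p = a_r_coset (mpoly_ring (verts G)) (edge_ideal G) p"

text \<open>
  The ideal of the edge ring generated by the variables, as the set of residue classes of polynomials
  without constant term.
\<close>
definition origin_ideal :: "'v sgraph \<Rightarrow> ('v, 'k::field) mpoly set set" where
  "origin_ideal G = edge_coset G ` {p \<in> polys (verts G). Poly_Mapping.lookup p 0 = 0}"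

lemma edge_ideal_ideal_of:
  assumes "simple_graph G"
  shows "ideal_of (polys (verts G)) (edge_ideal G :: ('v, 'k::field) mpoly set)"
  unfolding edge_ideal_eq[OF assms] by (rule supp_ideal_ideal) (auto simp: contains_edge_def)

lemma edge_ideal_lookup_zero:
  assumes "simple_graph G" "p \<in> (edge_ideal G :: ('v, 'k::field) mpoly set)"
  shows "Poly_Mapping.lookup p 0 = 0"
proof (rule ccontr)
  assume "Poly_Mapping.lookup p 0 \<noteq> 0"
  then have "0 \<in> Poly_Mapping.keys p" by (simp add: in_keys_iff)
  then have "contains_edge G (Poly_Mapping.keys (0 :: 'v \<Rightarrow>\<^sub>0 nat))"
    using assms(2) unfolding edge_ideal_eq[OF assms(1)] supp_ideal_def by blast
  then have "{} \<in> edges G" by (auto simp: contains_edge_def)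
  then show False using assms(1) by (auto simp: simple_graph_def)
qed

lemma edge_coset_hom:
  fixes G :: "'v sgraph"
  assumes "simple_graph G"
  shows "ring_hom_cring (mpoly_ring (verts G)) (edge_ring G)
           (edge_coset G :: ('v, 'k::field) mpoly \<Rightarrow> ('v, 'k) mpoly set)"
proof -
  interpret ideal "edge_ideal G :: ('v, 'k) mpoly set" "mpoly_ring (verts G)"
    by (rule ideal_mpoly_ring[OF edge_ideal_ideal_of[OF assms]])
  have "edge_coset G = (\<lambda>p :: ('v, 'k) mpoly. a_r_coset (mpoly_ring (verts G)) (edge_ideal G) p)"
    by (simp add: edge_coset_def fun_eq_iff)
  then show ?thesis
    unfolding edge_ring_def using rcos_ring_hom_cring[OF cring_mpoly_ring] by simp
qed

lemma edge_coset_eq_iff: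
  fixes p q :: "('v, 'k::field) mpoly"
  assumes "simple_graph G" "p \<in> polys (verts G)" "q \<in> polys (verts G)"
  shows "edge_coset G p = edge_coset G q \<longleftrightarrow> p - q \<in> edge_ideal G"
proof -
  interpret cring "mpoly_ring (verts G) :: ('v, 'k) mpoly ring" by (rule cring_mpoly_ring)
  show ?thesis
    using quotient_eq_iff_same_a_r_cos[OF ideal_mpoly_ring[OF edge_ideal_ideal_of[OF assms(1)]], of p q] assms
    by (simp add: edge_coset_def a_minus_mpoly_ring)
qed

lemma carrier_edge_ring:
  "carrier (edge_ring G :: ('v, 'k::field) mpoly set ring) = edge_coset G ` polys (verts G)"
  by (auto simp: edge_ring_def edge_coset_def FactRing_def A_RCOSETS_def')

lemma edge_coset_origin_iff:
  fixes p :: "('v, 'k::field) mpoly"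
  assumes "simple_graph G" "p \<in> polys (verts G)"
  shows "edge_coset G p \<in> origin_ideal G \<longleftrightarrow> Poly_Mapping.lookup p 0 = 0"
proof
  assume "edge_coset G p \<in> origin_ideal G"
  then obtain q where q: "q \<in> polys (verts G)" "Poly_Mapping.lookup q 0 = 0" "edge_coset G p = edge_coset G q"
    by (auto simp: origin_ideal_def)
  then have "p - q \<in> edge_ideal G" using edge_coset_eq_iff assms by blast
  then have "Poly_Mapping.lookup (p - q) 0 = 0" by (rule edge_ideal_lookup_zero[OF assms(1)])
  then show "Poly_Mapping.lookup p 0 = 0" using q(2) by (simp add: lookup_minus)
qed (use assms in \<open>auto simp: origin_ideal_def\<close>)

lemma maximalideal_origin:
  fixes G :: "'v sgraph"
  assumes G: "simple_graph G"
  shows "maximalideal (origin_ideal G) (edge_ring G :: ('v, 'k::field) mpoly set ring)"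
proof -
  let ?R = "edge_ring G :: ('v, 'k) mpoly set ring" and ?M = "origin_ideal G :: ('v, 'k) mpoly set set"
  let ?C = "polys (verts G) :: ('v, 'k) mpoly set"
  interpret h: ring_hom_cring "mpoly_ring (verts G)" ?R "edge_coset G"
    by (rule edge_coset_hom[OF G])
  have origin: "edge_coset G p \<in> ?M \<longleftrightarrow> Poly_Mapping.lookup p 0 = 0" if "p \<in> ?C" for p
    by (rule edge_coset_origin_iff[OF G that])
  have M_cases: thesis if "x \<in> ?M"
    "\<And>p. p \<in> ?C \<Longrightarrow> Poly_Mapping.lookup p 0 = 0 \<Longrightarrow> x = edge_coset G p \<Longrightarrow> thesis" for x thesis
    using that by (auto simp: origin_ideal_def)
  have R_cases: thesis if "x \<in> carrier ?R"
    "\<And>p. p \<in> ?C \<Longrightarrow> x = edge_coset G p \<Longrightarrow> thesis" for x thesis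
    using that by (auto simp: carrier_edge_ring)
  have ideal: "ideal ?M ?R"
  proof (rule idealI)
    show "ring ?R" by (rule h.S.ring_axioms)
    show "subgroup ?M (add_monoid ?R)"
    proof (rule h.S.add.subgroupI)
      show "?M \<subseteq> carrier ?R" by (auto simp: origin_ideal_def carrier_edge_ring)
      have "edge_coset G 0 \<in> ?M" using origin[OF polys_closed(2)] by simp
      then show "?M \<noteq> {}" by blast
    next
      fix x assume "x \<in> ?M"
      then obtain p where p: "p \<in> ?C" "Poly_Mapping.lookup p 0 = 0" "x = edge_coset G p" by (rule M_cases)
      have "\<ominus>\<^bsub>?R\<^esub> x = edge_coset G (- p)"
        unfolding p(3) using h.hom_a_inv[of p] p(1) by (simp add: a_inv_mpoly_ring)
      then show "\<ominus>\<^bsub>?R\<^esub> x \<in> ?M" using origin[OF polys_closed(6)[OF p(1)]] p(2) by simp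
    next
      fix x y assume "x \<in> ?M" "y \<in> ?M"
      obtain p where p: "p \<in> ?C" "Poly_Mapping.lookup p 0 = 0" "x = edge_coset G p"
        using \<open>x \<in> ?M\<close> by (rule M_cases)
      obtain q where q: "q \<in> ?C" "Poly_Mapping.lookup q 0 = 0" "y = edge_coset G q"
        using \<open>y \<in> ?M\<close> by (rule M_cases)
      have "x \<oplus>\<^bsub>?R\<^esub> y = edge_coset G (p + q)" using h.hom_add[of p q] p q by simp
      then show "x \<oplus>\<^bsub>?R\<^esub> y \<in> ?M"
        using origin[of "p + q"] p q by (simp add: polys_closed lookup_add)
    qed
    fix x y assume "x \<in> ?M" "y \<in> carrier ?R"
    obtain p where p: "p \<in> ?C" "Poly_Mapping.lookup p 0 = 0" "x = edge_coset G p"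
      using \<open>x \<in> ?M\<close> by (rule M_cases)
    obtain q where q: "q \<in> ?C" "y = edge_coset G q" using \<open>y \<in> carrier ?R\<close> by (rule R_cases)
    have "y \<otimes>\<^bsub>?R\<^esub> x = edge_coset G (q * p)" "x \<otimes>\<^bsub>?R\<^esub> y = edge_coset G (p * q)"
      using h.hom_mult[of p q] h.hom_mult[of q p] p q by simp_all
    then show "y \<otimes>\<^bsub>?R\<^esub> x \<in> ?M" "x \<otimes>\<^bsub>?R\<^esub> y \<in> ?M"
      using origin[of "q * p"] origin[of "p * q"] p q by (simp_all add: polys_closed lookup_mult_zero)
  qed
  show ?thesis
  proof (rule maximalidealI[OF ideal])
    have "edge_coset G 1 \<notin> ?M" using origin[OF polys_closed(1)] by simp
    moreover have "edge_coset G 1 \<in> carrier ?R" by (auto simp: carrier_edge_ring polys_closed)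
    ultimately show "carrier ?R \<noteq> ?M" by blast
    fix J assume J: "ideal J ?R" "?M \<subseteq> J" "J \<subseteq> carrier ?R"
    interpret J: ideal J ?R by (rule J(1))
    show "J = ?M \<or> J = carrier ?R"
    proof (rule disjCI)
      assume "J \<noteq> carrier ?R"
      have "x \<in> ?M" if x: "x \<in> J" for x
      proof (rule ccontr)
        assume "x \<notin> ?M"
        have "x \<in> carrier ?R" using x J(3) by blast
        then obtain p where p: "p \<in> ?C" "x = edge_coset G p" by (rule R_cases)
        let ?c = "Poly_Mapping.lookup p 0"
        let ?k = "\<lambda>c :: 'k. Poly_Mapping.single 0 c :: ('v, 'k) mpoly"
        have c: "?c \<noteq> 0" using \<open>x \<notin> ?M\<close> p origin by blast
        have "?k ?c - p \<in> ?C" by (rule polys_closed(4)[OF const_polys p(1)])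
        then have "edge_coset G (?k ?c - p) \<in> ?M" using origin[of "?k ?c - p"] by (simp add: lookup_minus)
        then have "edge_coset G (?k ?c - p) \<oplus>\<^bsub>?R\<^esub> x \<in> J" using J(2) x J.a_closed by blast
        moreover have "edge_coset G (?k ?c - p) \<oplus>\<^bsub>?R\<^esub> x = edge_coset G (?k ?c)"
          using h.hom_add[of "?k ?c - p" p] p \<open>?k ?c - p \<in> ?C\<close> by simp
        ultimately have "edge_coset G (?k ?c) \<in> J" by simp
        moreover have "edge_coset G (?k (1 / ?c)) \<in> carrier ?R" by (auto simp: carrier_edge_ring)
        ultimately have "edge_coset G (?k (1 / ?c)) \<otimes>\<^bsub>?R\<^esub> edge_coset G (?k ?c) \<in> J"
          by (rule J.I_l_closed)
        moreover have "edge_coset G (?k (1 / ?c)) \<otimes>\<^bsub>?R\<^esub> edge_coset G (?k ?c) = edge_coset G 1"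
          using h.hom_mult[of "?k (1 / ?c)" "?k ?c"] c by (simp add: mult_single)
        ultimately have "\<one>\<^bsub>?R\<^esub> \<in> J" using h.hom_one by simp
        then show False using J.one_imp_carrier \<open>J \<noteq> carrier ?R\<close> by blast
      qed
      then show "J = ?M" using J(2) by blast
    qed
  qed
qed

lemma edge_ring_local_fractions:
  fixes G :: "'v sgraph"
  assumes G: "simple_graph G"
  defines "A \<equiv> localization_at (edge_ring G :: ('v, 'k::field) mpoly set ring) (origin_ideal G)"
  assumes cring: "cring A" and noeth: "noetherian_ring A"
  shows "local_fractions A (polys (verts G)) {p \<in> polys (verts G). Poly_Mapping.lookup p 0 \<noteq> 0} (edge_ideal G)
           (\<lambda>p s. primeideal.fraction (origin_ideal G) (edge_ring G) (edge_coset G p) (edge_coset G s))"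
proof -
  let ?R = "edge_ring G :: ('v, 'k) mpoly set ring" and ?M = "origin_ideal G :: ('v, 'k) mpoly set set"
  let ?C = "polys (verts G) :: ('v, 'k) mpoly set" and ?I = "edge_ideal G :: ('v, 'k) mpoly set"
  let ?U = "{p \<in> ?C. Poly_Mapping.lookup p 0 \<noteq> 0}"
  interpret h: ring_hom_cring "mpoly_ring (verts G)" ?R "edge_coset G"
    by (rule edge_coset_hom[OF G])
  interpret P: primeideal ?M ?R
    by (rule h.S.maximalideal_prime[OF maximalideal_origin[OF G]])
  let ?\<phi> = "\<lambda>p s. P.fraction (edge_coset G p) (edge_coset G s)"
  have hC: "edge_coset G p \<in> carrier ?R" if "p \<in> ?C" for p
    using that by (auto simp: carrier_edge_ring)
  have hU: "edge_coset G s \<in> carrier ?R - ?M" if "s \<in> ?U" for s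
    using that hC edge_coset_origin_iff[OF G] by auto
  have denoms: "carrier ?R - ?M = edge_coset G ` ?U"
    using hU edge_coset_origin_iff[OF G] by (auto simp: carrier_edge_ring)
  have h_mult: "edge_coset G p \<otimes>\<^bsub>?R\<^esub> edge_coset G q = edge_coset G (p * q)"
    and h_add: "edge_coset G p \<oplus>\<^bsub>?R\<^esub> edge_coset G q = edge_coset G (p + q)"
    and h_diff: "edge_coset G p \<ominus>\<^bsub>?R\<^esub> edge_coset G q = edge_coset G (p - q)"
    if "p \<in> ?C" "q \<in> ?C" for p q
    using h.hom_mult[of p q] h.hom_add[of p q] h.hom_add[of p "- q"] h.hom_a_inv[of q] that
    by (simp_all add: a_minus_def a_inv_mpoly_ring polys_closed)
  have h_zero: "edge_coset G 0 = \<zero>\<^bsub>?R\<^esub>" and h_one: "edge_coset G 1 = \<one>\<^bsub>?R\<^esub>"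
    using h.hom_zero h.hom_one by simp_all
  have h_eq_zero: "edge_coset G p = \<zero>\<^bsub>?R\<^esub> \<longleftrightarrow> p \<in> ?I" if "p \<in> ?C" for p
    using edge_coset_eq_iff[OF G that polys_closed(2)] by (simp add: h_zero)
  have UC: "s \<in> ?C" if "s \<in> ?U" for s using that by simp
  show ?thesis
  proof (intro local_fractions.intro local_fractions_axioms.intro)
    show "cring A" "noetherian_ring A" by (fact cring noeth)+
    show "subring_set ?C" by (rule subring_polys)
    show "ideal_of ?C ?I" by (rule edge_ideal_ideal_of[OF G])
    show "?U \<subseteq> ?C" by blast
    show "1 \<in> ?U" by (simp add: polys_closed)
    show "s * t \<in> ?U" if "s \<in> ?U" "t \<in> ?U" for s t
      using that by (simp add: polys_closed lookup_mult_zero)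
    show "c * p \<notin> ?U" if "c \<in> ?C" "p \<in> ?C - ?U" for c p
      using that by (simp add: lookup_mult_zero)
    show "s + p \<in> ?U" if "s \<in> ?U" "p \<in> ?C - ?U" for s p
      using that by (simp add: polys_closed lookup_add)
    show "carrier A = {?\<phi> p s | p s. p \<in> ?C \<and> s \<in> ?U}"
      unfolding A_def P.carrier_localization_at denoms unfolding carrier_edge_ring
    proof (intro equalityI subsetI)
      fix x assume "x \<in> {P.fraction r s | r s. r \<in> edge_coset G ` ?C \<and> s \<in> edge_coset G ` ?U}"
      then obtain p s where "p \<in> ?C" "s \<in> ?U" "x = ?\<phi> p s" by auto
      then show "x \<in> {?\<phi> p s | p s. p \<in> ?C \<and> s \<in> ?U}" by blast
    qed auto
    show "\<one>\<^bsub>A\<^esub> = ?\<phi> 1 1" "\<zero>\<^bsub>A\<^esub> = ?\<phi> 0 1"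
      unfolding A_def P.one_localization_at P.zero_localization_at h_zero h_one by (rule refl)+
    fix p s q t assume *: "p \<in> ?C" "s \<in> ?U" "q \<in> ?C" "t \<in> ?U"
    note ** = hC[OF *(1)] hU[OF *(2)] hC[OF *(3)] hU[OF *(4)]
    note C = *(1,3) UC[OF *(2)] UC[OF *(4)]
    show "?\<phi> p s \<otimes>\<^bsub>A\<^esub> ?\<phi> q t = ?\<phi> (p * q) (s * t)"
      unfolding A_def P.fraction_mult[OF **] using C h_mult by simp
    show "?\<phi> p s \<oplus>\<^bsub>A\<^esub> ?\<phi> q t = ?\<phi> (p * t + q * s) (s * t)"
      unfolding A_def P.fraction_add[OF **] using C by (simp add: h_mult h_add polys_closed)
    have "edge_coset G u \<otimes>\<^bsub>?R\<^esub> (edge_coset G p \<otimes>\<^bsub>?R\<^esub> edge_coset G t \<ominus>\<^bsub>?R\<^esub> edge_coset G q \<otimes>\<^bsub>?R\<^esub> edge_coset G s)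
        = edge_coset G (u * (p * t - q * s))" "u * (p * t - q * s) \<in> ?C" if "u \<in> ?U" for u
      using C UC[OF that] by (simp_all add: h_mult h_diff polys_closed)
    then show "?\<phi> p s = ?\<phi> q t \<longleftrightarrow> (\<exists>u\<in>?U. u * (p * t - q * s) \<in> ?I)"
      unfolding P.fraction_eq_iff[OF **] denoms by (simp add: h_eq_zero)
  qed
qed

text \<open>
  Cohen--Macaulay graphs are well-covered. Localize the edge ring at the ideal of the variables. An
  independent set \<open>S\<close> gives a chain of \<open>card S + 1\<close> primes, generated by the variables outside a
  decreasing chain of subsets of \<open>S\<close>, so the dimension is at least \<open>card S\<close>; for a maximal independent
  set \<open>T\<close> the depth is at most \<open>card T\<close>.
\<close>
lemma cohen_macaulay_well_covered:
  fixes G :: "'v sgraph"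
  assumes G: "simple_graph G" and CM: "cohen_macaulay_graph TYPE('k::field) G"
    and S: "finite_graph.independent G S" and T: "finite_graph.maximal_independent G T"
  shows "card S \<le> card T"
proof (rule ccontr)
  assume less: "\<not> card S \<le> card T"
  interpret finite_graph G by unfold_locales (rule G)
  let ?E = "edge_ideal G :: ('v, 'k) mpoly set"
  let ?C = "polys (verts G) :: ('v, 'k) mpoly set"
  let ?U = "{p \<in> ?C. Poly_Mapping.lookup p 0 \<noteq> 0}"
  let ?R = "edge_ring G :: ('v, 'k) mpoly set ring"
  let ?M = "origin_ideal G :: ('v, 'k) mpoly set set"
  define A where "A = localization_at ?R ?M"
  define \<phi> where "\<phi> = (\<lambda>p s. primeideal.fraction ?M ?R (edge_coset G p) (edge_coset G s))"
  have "maximalideal ?M ?R"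
    by (rule maximalideal_origin[OF G])
  then have "cohen_macaulay_local_ring A"
    using CM unfolding cohen_macaulay_graph_def cohen_macaulay_ring_def A_def edge_ring_def by blast
  then have A: "cring A" "noetherian_ring A" "\<exists>!N. maximalideal N A"
    and depth: "\<And>N. maximalideal N A \<Longrightarrow> depth A N = krull_dim A"
    by (auto simp: cohen_macaulay_local_ring_def noetherian_local_ring_def)
  obtain N where N: "maximalideal N A" using A(3) by blast
  interpret local_fractions A ?C ?U ?E \<phi>
    using A(1,2) unfolding A_def \<phi>_def by (rule edge_ring_local_fractions[OF G])
  have indS: "S \<subseteq> verts G" "\<And>u v. u \<in> S \<Longrightarrow> v \<in> S \<Longrightarrow> \<not> adj u v"
    using S by (auto simp: independent_def)
  have finS: "finite S" using S by (rule independent_finite)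
  obtain l where l: "distinct l" "set l = S" using finite_distinct_list[OF finS] by blast
  let ?n = "length l"
  define P :: "nat \<Rightarrow> ('v, 'k) mpoly set"
    where "P i = supp_ideal (verts G) (\<lambda>B. \<not> B \<subseteq> set (drop i l))" for i
  define Q where "Q i = {x. \<exists>p\<in>P i. \<exists>s\<in>?U. x = \<phi> p s}" for i
  have P_ideal: "ideal_of ?C (P i)" for i
    unfolding P_def by (rule supp_ideal_ideal) blast
  have E_sub: "?E \<subseteq> P i" for i
  proof -
    have "\<not> B \<subseteq> set (drop i l)" if B: "contains_edge G B" for B
    proof
      assume "B \<subseteq> set (drop i l)"
      then obtain e where e: "e \<in> edges G" "e \<subseteq> S"
        using B set_drop_subset[of i l] l(2) unfolding contains_edge_def by blast
      obtain u v where "e = {u, v}" using edge_cases[OF e(1)] by blast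
      then show False using e indS(2) by auto
    qed
    then show ?thesis unfolding edge_ideal_eq[OF G] P_def supp_ideal_def by blast
  qed
  have P_U: "P i \<inter> ?U = {}" for i
  proof -
    have "0 \<notin> Poly_Mapping.keys p" if "p \<in> P i" for p
      using that unfolding P_def supp_ideal_def by fastforce
    then show ?thesis by (auto simp: in_keys_iff)
  qed
  have P_prime: "p \<in> P i \<or> q \<in> P i" if "p \<in> ?C" "q \<in> ?C" "p * q \<in> P i" for p q i
    using that unfolding P_def by (intro supp_ideal_prime) auto
  have Q_prime: "primeideal (Q i) A" for i
    unfolding Q_def by (rule primeideal_fractions(1)[OF P_ideal E_sub P_U P_prime])
  have mem: "\<phi> p s \<in> Q i \<longleftrightarrow> p \<in> P i" if "p \<in> ?C" "s \<in> ?U" for p s i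
    unfolding Q_def by (rule primeideal_fractions(2)[OF P_ideal E_sub P_U _ that]) (rule P_prime)
  have Q_less: "Q i \<subset> Q (Suc i)" if i: "i < ?n" for i
  proof
    have "set (drop (Suc i) l) \<subseteq> set (drop i l)"
      using set_drop_subset_set_drop[of i "Suc i" l] by simp
    then have "P i \<subseteq> P (Suc i)" unfolding P_def supp_ideal_def by blast
    then show "Q i \<subseteq> Q (Suc i)" unfolding Q_def by blast
    let ?v = "l ! i"
    have d: "drop i l = ?v # drop (Suc i) l" using i by (simp add: Cons_nth_drop_Suc)
    have "distinct (drop i l)" using l(1) by simp
    then have v: "?v \<in> set (drop i l)" "?v \<notin> set (drop (Suc i) l)" unfolding d by auto
    have vV: "?v \<in> verts G" using i l(2) indS(1) nth_mem by blast
    have k: "Poly_Mapping.keys (mpoly_var ?v :: ('v, 'k) mpoly) = {Poly_Mapping.single ?v 1}"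
      by (simp add: mpoly_var_def)
    have vC: "(mpoly_var ?v :: ('v, 'k) mpoly) \<in> ?C" using vV by (simp add: polys_def k)
    have "mpoly_var ?v \<in> P (Suc i)" "mpoly_var ?v \<notin> P i"
      using v vC by (auto simp: P_def supp_ideal_def k)
    then have "\<phi> (mpoly_var ?v) 1 \<in> Q (Suc i)" "\<phi> (mpoly_var ?v) 1 \<notin> Q i"
      using mem[OF vC U_one] by auto
    then show "Q i \<noteq> Q (Suc i)" by blast
  qed
  have "enat ?n \<le> krull_dim A"
    unfolding krull_dim_def by (rule Sup_upper) (use Q_prime Q_less in blast)
  moreover have "?n = card S" using l distinct_card by metis
  ultimately have "enat (card T) < depth A N"
    using less depth[OF N] by (metis enat_ord_simps(2) less_le_trans not_le_imp_less)
  then obtain xs where xs: "card T < length xs" "set xs \<subseteq> N" "regular_sequence A xs"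
    unfolding depth_def less_Sup_iff by auto
  obtain J fs where J: "length fs = length xs" "regular_chain ?C J fs"
      "J 0 = {p \<in> ?C. \<exists>u\<in>?U. u * p \<in> ?E}"
    by (rule regular_sequence_pullback[OF xs(3) N xs(2)])
  have "length fs \<le> card T"
    by (rule depth_le_maximal_independent[OF G T J(2)]) (use J(3) in auto)
  then show False using xs(1) J(1) by simp
qed

section \<open>Cohen--Macaulay chordal graphs\<close>

theorem lemma4p2:
  fixes G :: "'v sgraph" and m :: nat and F :: "nat \<Rightarrow> 'v set" and w :: "nat \<Rightarrow> 'v"
  assumes "simple_graph G"
    and "chordal G"
    and "cohen_macaulay_graph TYPE('k::field) G"
    and "bij_betw F {1..m} {C. maximal_clique G C \<and> (\<exists>v\<in>C. free_vertex G v)}"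
    and "\<forall>i\<in>{1..m}. w i \<in> F i \<and> free_vertex G (w i)"
  shows "clique_partition (delete_verts G (w ` {1..m})) {1..m} (\<lambda>i. F i - {w i}) \<and>
         whisker_vertices (delete_verts G (w ` {1..m})) {1..m} w \<and>
         G = clique_whiskered (delete_verts G (w ` {1..m})) {1..m} (\<lambda>i. F i - {w i}) w"
proof -
  interpret chordal_graph G by unfold_locales (fact assms)+
  show ?thesis
    by (rule well_covered_clique_whiskered[OF _ assms(4,5)])
      (rule cohen_macaulay_well_covered[OF assms(1,3)])
qed

end
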